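(* Let $2\le n\le 6$, let $\Omega\subset\mathbb{R}^n$ be a bounded $C^{1,1}$ domain, let $0<\alpha<1$, and let $M>0$, $\epsilon>0$. Then there is a constant $\delta=\delta(\Omega,M,\epsilon)>0$ such that the following holds: if $u$ is a positive stable solution of $\Delta u=\frac1u$ on $\Omega$ with boundary data $\varphi\in C^{2,\alpha}(\Omega)$ satisfying $|\varphi|_{2,\alpha}\le M$ and $\varphi\ge\epsilon$, then $u\ge\delta$ on $\Omega$.
   Context: $|\varphi|_{2,\alpha}$ denotes the $C^{2,\alpha}$ H\"older norm of $\varphi$ on $\Omega$ (and $\varphi$ is extended continuously to $\overline\Omega$). A positive stable solution $u$ with boundary data $\varphi$ is a positive function, smooth in $\Omega$ and continuous on $\overline\Omega$, with $u=\varphi$ on $\partial\Omega$, satisfying $\Delta u=\frac1u$ in $\Omega$ and $\int_\Omega \frac{\zeta^2}{u^2}\le\int_\Omega|D\zeta|^2$ for all test functions $\zeta\in C_c^1(\Omega)$. *)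

theory Defs
  imports "HOL-Analysis.Analysis"
begin

definition partial_deriv :: "'n::finite \<Rightarrow> (real^'n \<Rightarrow> real) \<Rightarrow> real^'n \<Rightarrow> real" where
  "partial_deriv i f x = deriv (\<lambda>t. f (x + t *\<^sub>R axis i 1)) 0"

definition grad :: "(real^'n \<Rightarrow> real) \<Rightarrow> real^'n \<Rightarrow> real^'n" where
  "grad f x = (\<chi> i. partial_deriv i f x)"

definition laplacian :: "(real^'n \<Rightarrow> real) \<Rightarrow> real^'n \<Rightarrow> real" where
  "laplacian f x = (\<Sum>i\<in>UNIV. partial_deriv i (partial_deriv i f) x)"

(* Intended for open S: there the partial derivatives, defined through values of f near
   the point, do not depend on f outside S. *)
primrec Ck_on :: "nat \<Rightarrow> (real^'n) set \<Rightarrow> (real^'n \<Rightarrow> real) \<Rightarrow> bool" where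
  "Ck_on 0 S f \<longleftrightarrow> continuous_on S f"
| "Ck_on (Suc k) S f \<longleftrightarrow> f differentiable_on S \<and> (\<forall>i. Ck_on k S (partial_deriv i f))"

definition smooth_on :: "(real^'n) set \<Rightarrow> (real^'n \<Rightarrow> real) \<Rightarrow> bool" where
  "smooth_on S f \<longleftrightarrow> (\<forall>k. Ck_on k S f)"

(* Suprema and norms take values in ennreal, so an unbounded quantity has norm infinity. *)

definition sup_norm_on :: "(real^'n) set \<Rightarrow> (real^'n \<Rightarrow> real) \<Rightarrow> ennreal" where
  "sup_norm_on S f = (SUP x\<in>S. ennreal \<bar>f x\<bar>)"

definition holder_seminorm :: "real \<Rightarrow> (real^'n) set \<Rightarrow> (real^'n \<Rightarrow> real) \<Rightarrow> ennreal" where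
  "holder_seminorm \<alpha> S f =
     (SUP p\<in>{(x, y). x \<in> S \<and> y \<in> S \<and> x \<noteq> y}.
        ennreal (\<bar>f (fst p) - f (snd p)\<bar> / dist (fst p) (snd p) powr \<alpha>))"

(* Convention of Gilbarg and Trudinger: the norm of the j-th order derivatives is the
   maximum over all partial derivatives of order j. *)
definition holder_norm2 :: "real \<Rightarrow> (real^'n) set \<Rightarrow> (real^'n \<Rightarrow> real) \<Rightarrow> ennreal" where
  "holder_norm2 \<alpha> S f =
     sup_norm_on S f
     + (SUP i. sup_norm_on S (partial_deriv i f))
     + (SUP i. SUP j. sup_norm_on S (partial_deriv i (partial_deriv j f)))
     + (SUP i. SUP j. holder_seminorm \<alpha> S (partial_deriv i (partial_deriv j f)))"

definition C2_holder_on :: "real \<Rightarrow> (real^'n) set \<Rightarrow> (real^'n \<Rightarrow> real) \<Rightarrow> bool" where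
  "C2_holder_on \<alpha> S f \<longleftrightarrow> Ck_on 2 S f \<and> holder_norm2 \<alpha> S f < \<infinity>"

definition C11_function :: "(real^'n \<Rightarrow> real) \<Rightarrow> bool" where
  "C11_function g \<longleftrightarrow>
     g differentiable_on UNIV \<and> (\<exists>L. L-lipschitz_on UNIV (grad g))"

(* Near each boundary point, the domain is the region strictly above the graph of a C^{1,1}
   function g over the hyperplane orthogonal to a unit vector \<nu>. Only the values
   of g on that hyperplane matter. *)
definition bounded_C11_domain :: "(real^'n) set \<Rightarrow> bool" where
  "bounded_C11_domain \<Omega> \<longleftrightarrow>
     open \<Omega> \<and> connected \<Omega> \<and> \<Omega> \<noteq> {} \<and> bounded \<Omega> \<and>
     (\<forall>p\<in>frontier \<Omega>. \<exists>r>0. \<exists>\<nu> g. norm \<nu> = 1 \<and> C11_function g \<and>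
        \<Omega> \<inter> ball p r = {x \<in> ball p r. x \<bullet> \<nu> > g (x - (x \<bullet> \<nu>) *\<^sub>R \<nu>)})"

definition test_function :: "(real^'n) set \<Rightarrow> (real^'n \<Rightarrow> real) \<Rightarrow> bool" where
  "test_function \<Omega> \<zeta> \<longleftrightarrow>
     Ck_on 1 \<Omega> \<zeta> \<and> (\<exists>K. compact K \<and> K \<subseteq> \<Omega> \<and> (\<forall>x\<in>\<Omega> - K. \<zeta> x = 0))"

definition stable :: "(real^'n) set \<Rightarrow> (real^'n \<Rightarrow> real) \<Rightarrow> bool" where
  "stable \<Omega> u \<longleftrightarrow>
     (\<forall>\<zeta>. test_function \<Omega> \<zeta> \<longrightarrow>
        (LINT x:\<Omega>|lborel. (\<zeta> x)\<^sup>2 / (u x)\<^sup>2) \<le> (LINT x:\<Omega>|lborel. (norm (grad \<zeta> x))\<^sup>2))"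

definition positive_stable_solution ::
  "(real^'n) set \<Rightarrow> (real^'n \<Rightarrow> real) \<Rightarrow> (real^'n \<Rightarrow> real) \<Rightarrow> bool" where
  "positive_stable_solution \<Omega> \<phi> u \<longleftrightarrow>
     (\<forall>x\<in>\<Omega>. u x > 0) \<and> smooth_on \<Omega> u \<and> continuous_on (closure \<Omega>) u \<and>
     (\<forall>x\<in>frontier \<Omega>. u x = \<phi> x) \<and>
     (\<forall>x\<in>\<Omega>. laplacian u x = 1 / u x) \<and>
     stable \<Omega> u"

end

theory Submission
  imports Defs
begin

text \<open>
  The bound comes from an integral estimate for a power of \<open>1 / u\<close>, which stability provides, and a
  mean value argument, which turns it into a pointwise bound when the power exceeds the dimension.

  Let \<open>k = \<epsilon> / 2\<close>. On the frontier \<open>u = \<phi> \<ge> \<epsilon>\<close>, so every function of \<open>u\<close> that vanishes above level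
  \<open>k\<close> has compact support in \<open>\<Omega>\<close>. The stability inequality may therefore be tested with a power
  \<open>u powr - q\<close> cut off at level \<open>k\<close>, and the equation with \<open>u powr - (2 * q + 1)\<close> cut off in the same
  way. Both produce the integral of \<open>u powr - (2 * q + 2)\<close> times the squared gradient of \<open>u\<close>;
  eliminating it leaves a bound for the integral of \<open>u powr - (2 * q + 2)\<close> over the set where
  \<open>u \<le> k\<close>, provided that \<open>q\<^sup>2 < 2 * q + 1\<close>. The choice \<open>q = 7 / 3\<close> gives the power \<open>20 / 3 > 6\<close>
  (lemma \<open>reciprocal_power_bound\<close>). The bound depends on \<open>\<epsilon>\<close> and the volume of \<open>\<Omega>\<close>, and it holds up to
  the boundary.

  For the pointwise bound, \<open>u\<close> is composed with a concave function that is constant above level \<open>k\<close>.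
  The result \<open>v\<close> extends to a positive twice continuously differentiable function on the whole
  space, it lies below \<open>u\<close> in \<open>\<Omega>\<close>, and its Laplacian is at most \<open>1 / v\<close>. If \<open>v\<close> were tiny at a
  point, then the inequality for the Laplacian and the integral bound for \<open>1 / v\<close> would keep the
  means of \<open>v\<close> over small balls about that point small; but then the means of \<open>1 / v\<close> would be larger
  than the integral bound permits. Lemma \<open>mean_value_reciprocal_lower_bound\<close> makes this
  quantitative. Because the balls may leave \<open>\<Omega>\<close>, the distance to the boundary does not enter.\<close>

section \<open>Integrals of compactly supported functions\<close>

lemma integrable_compact_support:
  fixes f :: "'a::euclidean_space \<Rightarrow> real"
  assumes "continuous_on UNIV f" "compact S" "\<And>x. x \<notin> S \<Longrightarrow> f x = 0"
  shows "integrable lborel f"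
proof -
  have "integrable lborel (\<lambda>x. indicator S x *\<^sub>R f x)"
    using assms by (intro borel_integrable_compact) (auto intro: continuous_on_subset)
  also have "(\<lambda>x. indicator S x *\<^sub>R f x) = f"
    using assms(3) by (auto simp: indicator_def fun_eq_iff)
  finally show ?thesis .
qed

lemma DERIV_integral_lborel:
  fixes f :: "real \<Rightarrow> 'a::euclidean_space \<Rightarrow> real"
  assumes f: "\<And>r x. r \<in> U \<Longrightarrow> ((\<lambda>r. f r x) has_field_derivative f' r x) (at r within U)"
    and cont: "\<And>r. r \<in> U \<Longrightarrow> continuous_on UNIV (f r)"
    and cont': "continuous_on (U \<times> UNIV) (\<lambda>(r, x). f' r x)"
    and supp: "\<And>r x. r \<in> U \<Longrightarrow> x \<notin> cbox a b \<Longrightarrow> f r x = 0 \<and> f' r x = 0"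
    and U: "r \<in> U" "convex U"
  shows "((\<lambda>r. LINT x|lborel. f r x) has_field_derivative (LINT x|lborel. f' r x)) (at r within U)"
proof -
  have cf': "continuous_on UNIV (f' s)" if "s \<in> U" for s
  proof -
    have "continuous_on UNIV (\<lambda>x::'a. (s, x))" by (intro continuous_intros)
    from continuous_on_compose2[OF cont' this] that show ?thesis by auto
  qed
  have eq: "integral (cbox a b) g = (LINT x|lborel. g x)"
    if "continuous_on UNIV g" "\<And>x. x \<notin> cbox a b \<Longrightarrow> g x = 0" for g :: "'a \<Rightarrow> real"
  proof -
    have "set_integrable lborel (cbox a b) g"
      unfolding set_integrable_def
      using that(1) by (intro borel_integrable_compact) (auto intro: continuous_on_subset)
    then have "integral (cbox a b) g = (LINT x:cbox a b|lborel. g x)"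
      by (simp add: set_borel_integral_eq_integral)
    also have "\<dots> = (LINT x|lborel. g x)"
      unfolding set_lebesgue_integral_def
      using that(2) by (intro Bochner_Integration.integral_cong) (auto simp: indicator_def)
    finally show ?thesis .
  qed
  have "((\<lambda>r. integral (cbox a b) (f r)) has_field_derivative integral (cbox a b) (f' r))
      (at r within U)"
    using f U cont
    by (intro leibniz_rule_field_derivative continuous_on_subset[OF cont'] integrable_continuous)
      (auto intro: continuous_on_subset)
  moreover have "integral (cbox a b) (f' r) = (LINT x|lborel. f' r x)"
    using supp U by (intro eq cf') auto
  moreover have eqf: "(LINT x|lborel. f s x) = integral (cbox a b) (f s)" if "s \<in> U" for s
    using supp that by (intro eq[symmetric] cont) auto
  ultimately have "((\<lambda>r. integral (cbox a b) (f r)) has_derivative (*) (LINT x|lborel. f' r x))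
      (at r within U)"
    by (simp add: has_field_derivative_def)
  from has_derivative_transform[OF U(1) _ this, of "\<lambda>s. LINT x|lborel. f s x"]
  show ?thesis
    using eqf by (simp add: has_field_derivative_def)
qed

lemma integral_lborel_translate:
  fixes f :: "'a::euclidean_space \<Rightarrow> real"
  assumes "f \<in> borel_measurable borel"
  shows "(LINT x|lborel. f (c + x)) = (LINT x|lborel. f x)"
proof -
  have "(LINT x|lborel. f x) = (LINT x|distr lborel borel ((+) c). f x)"
    by (simp add: lborel_distr_plus)
  also have "\<dots> = (LINT x|lborel. f (c + x))"
    using assms by (subst integral_distr) auto
  finally show ?thesis by simp
qed

lemma integral_lborel_scale:
  fixes f :: "real^'n \<Rightarrow> real"
  assumes f: "integrable lborel f" and r: "0 < r"
  shows "integrable lborel (\<lambda>y. f (c + r *\<^sub>R y))"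
    and "(LINT y|lborel. f (c + r *\<^sub>R y)) = (LINT x|lborel. f x) / r ^ CARD('n)"
proof -
  let ?T = "\<lambda>y::real^'n. c + r *\<^sub>R y"
  have [measurable]: "f \<in> borel_measurable borel" using f by auto
  have L: "lborel = density (distr lborel borel ?T) (\<lambda>_. ennreal (r ^ CARD('n)))"
    using lborel_affine[of r c] r by simp
  have "integrable (density (distr lborel borel ?T) (\<lambda>_. ennreal (r ^ CARD('n)))) f"
    using f L by simp
  then have "integrable (distr lborel borel ?T) (\<lambda>x. r ^ CARD('n) *\<^sub>R f x)"
    using r by (subst (asm) integrable_density) auto
  then show "integrable lborel (\<lambda>y. f (?T y))"
    using r by (subst (asm) integrable_distr_eq) auto
  have "(LINT x|lborel. f x)
      = (LINT x|density (distr lborel borel ?T) (\<lambda>_. ennreal (r ^ CARD('n))). f x)"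
    using L by simp
  also have "\<dots> = r ^ CARD('n) * (LINT y|lborel. f (?T y))"
    using r by (subst integral_density) (auto simp: integral_distr)
  finally show "(LINT y|lborel. f (?T y)) = (LINT x|lborel. f x) / r ^ CARD('n)"
    using r by simp
qed

lemma GDERIV_imp_directional:
  fixes f :: "'a::real_inner \<Rightarrow> real"
  assumes "GDERIV f (x + t *\<^sub>R e) :> D"
  shows "((\<lambda>t. f (x + t *\<^sub>R e)) has_field_derivative e \<bullet> D) (at t within S)"
proof -
  have "((\<lambda>t. f (x + t *\<^sub>R e)) has_derivative (\<lambda>h. (h *\<^sub>R e) \<bullet> D)) (at t within S)"
    by (rule has_derivative_compose[where f = "\<lambda>t. x + t *\<^sub>R e" and g = f,
          OF _ assms[unfolded gderiv_def]])
      (auto intro!: derivative_eq_intros)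
  then show ?thesis
    by (simp add: has_field_derivative_def mult_commute_abs)
qed

lemma GDERIV_imp_continuous:
  fixes f :: "'a::real_inner \<Rightarrow> real"
  assumes "\<And>x. GDERIV f x :> D x"
  shows "continuous_on S f"
  by (intro continuous_at_imp_continuous_on ballI)
    (rule has_derivative_continuous[OF assms[unfolded gderiv_def]])

lemma GDERIV_affine:
  fixes f :: "'a::real_inner \<Rightarrow> real"
  assumes "GDERIV f (c + r *\<^sub>R y) :> D"
  shows "GDERIV (\<lambda>y. f (c + r *\<^sub>R y)) y :> r *\<^sub>R D"
proof -
  have "((\<lambda>y. f (c + r *\<^sub>R y)) has_derivative (\<lambda>h. (r *\<^sub>R h) \<bullet> D)) (at y)"
    by (rule has_derivative_compose[where f = "\<lambda>y. c + r *\<^sub>R y" and g = f,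
          OF _ assms[unfolded gderiv_def]])
      (auto intro!: derivative_eq_intros)
  then show ?thesis by (simp add: gderiv_def)
qed

text \<open>The integral of a translate of \<open>f\<close> does not depend on the translation, and the
  partial derivative is the derivative of the translates. Summed over the components of a field
  this is the divergence theorem without boundary term, the only integration by parts below.\<close>

lemma integral_partial_eq_0:
  fixes f :: "real^'n \<Rightarrow> real"
  assumes f: "\<And>x. GDERIV f x :> D x"
    and cont: "continuous_on UNIV (\<lambda>x. D x $ i)"
    and supp: "bounded S" "\<And>x. x \<notin> S \<Longrightarrow> f x = 0 \<and> D x $ i = 0"
  shows "integrable lborel (\<lambda>x. D x $ i)" "(LINT x|lborel. D x $ i) = 0"
proof -
  let ?e = "axis i 1 :: real^'n"
  obtain R where R: "S \<subseteq> cball 0 R"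
    using \<open>bounded S\<close> bounded_any_center[of S 0] by (auto simp: subset_eq)
  show "integrable lborel (\<lambda>x. D x $ i)"
  proof (rule integrable_compact_support[OF cont])
    show "D x $ i = 0" if "x \<notin> cball 0 R" for x
      using that R supp(2) by blast
  qed (rule compact_cball)
  \<comment> \<open>The box contains the support of every translate by at most one unit.\<close>
  obtain a b where ab: "cball (0::real^'n) (R + 1) \<subseteq> cbox a b"
    using bounded_cball bounded_subset_cbox_symmetric by meson
  have cf: "continuous_on UNIV f" using f by (rule GDERIV_imp_continuous)
  have far: "x + t *\<^sub>R ?e \<notin> S" if "t \<in> {-1..1}" "x \<notin> cbox a b" for x t
  proof
    assume "x + t *\<^sub>R ?e \<in> S"
    then have "norm (x + t *\<^sub>R ?e) \<le> R" using R by auto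
    moreover have "norm (t *\<^sub>R ?e) \<le> 1" using that(1) by (auto simp: norm_axis_1)
    moreover have "norm x \<le> norm (x + t *\<^sub>R ?e) + norm (t *\<^sub>R ?e)"
      using norm_triangle_ineq4[of "x + t *\<^sub>R ?e" "t *\<^sub>R ?e"] by simp
    ultimately have "x \<in> cball 0 (R + 1)" by simp
    then show False using ab that(2) by blast
  qed
  have "((\<lambda>t. LINT x|lborel. f (x + t *\<^sub>R ?e)) has_field_derivative
      (LINT x|lborel. D (x + 0 *\<^sub>R ?e) $ i)) (at 0 within {-1..1})"
  proof (rule DERIV_integral_lborel[where a = a and b = b])
    show "((\<lambda>r. f (x + r *\<^sub>R ?e)) has_field_derivative D (x + r *\<^sub>R ?e) $ i) (at r within {-1..1})"
      for r x
      using GDERIV_imp_directional[of f x r ?e, OF f] by (simp add: inner_axis')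
    show "continuous_on UNIV (\<lambda>x. f (x + r *\<^sub>R ?e))" for r
      by (intro continuous_on_compose2[OF cf] continuous_intros) auto
    show "continuous_on ({-1..1} \<times> UNIV) (\<lambda>(r, x). D (x + r *\<^sub>R ?e) $ i)"
      unfolding case_prod_beta
      by (rule continuous_on_compose2[OF cont, where f = "\<lambda>p. snd p + fst p *\<^sub>R ?e"])
        (auto intro!: continuous_intros)
    show "f (x + r *\<^sub>R ?e) = 0 \<and> D (x + r *\<^sub>R ?e) $ i = 0"
      if "r \<in> {-1..1}" "x \<notin> cbox a b" for r x
      by (rule supp(2)[OF far[OF that]])
  qed auto
  moreover have "(LINT x|lborel. f (x + t *\<^sub>R ?e)) = (LINT x|lborel. f x)" for t
    using integral_lborel_translate[of f "t *\<^sub>R ?e"] borel_measurable_continuous_onI[OF cf]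
    by (simp add: add.commute)
  ultimately have "((\<lambda>t::real. LINT x|lborel. f x) has_field_derivative
      (LINT x|lborel. D x $ i)) (at 0 within {-1..1})" by simp
  then have "((\<lambda>t::real. LINT x|lborel. f x) has_field_derivative (LINT x|lborel. D x $ i)) (at 0)"
    by (simp add: at_within_Icc_at)
  from DERIV_unique[OF this DERIV_const] show "(LINT x|lborel. D x $ i) = 0" .
qed

section \<open>A lower bound for functions with Laplacian at most their reciprocal\<close>

lemma DERIV_max_0_power:
  "((\<lambda>t::real. max 0 t ^ (m + 2)) has_field_derivative real (m + 2) * max 0 t ^ (m + 1)) (at t)"
proof (cases "t = 0")
  case True
  have "((\<lambda>h::real. max 0 h ^ (m + 2) / h) \<longlongrightarrow> 0) (at 0)"
  proof (rule Lim_null_comparison)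
    show "\<forall>\<^sub>F h::real in at 0. norm (max 0 h ^ (m + 2) / h) \<le> \<bar>h\<bar> ^ (m + 1)"
    proof (rule always_eventually, rule allI)
      fix h :: real
      show "norm (max 0 h ^ (m + 2) / h) \<le> \<bar>h\<bar> ^ (m + 1)"
      proof (cases "h > 0")
        case True
        then show ?thesis by (auto simp: max_def field_simps)
      next
        case False
        then have "norm (max 0 h ^ (m + 2) / h) = 0" by simp
        then show ?thesis using zero_le_power[OF abs_ge_zero[of h], of "m + 1"] by linarith
      qed
    qed
    show "((\<lambda>h::real. \<bar>h\<bar> ^ (m + 1)) \<longlongrightarrow> 0) (at 0)"
      by (auto intro!: tendsto_eq_intros)
  qed
  then show ?thesis using True by (simp add: DERIV_def)
next
  case False
  then consider "t > 0" | "t < 0" by linarith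
  then show ?thesis
  proof cases
    case 1
    have "((\<lambda>t::real. t ^ (m + 2)) has_field_derivative real (m + 2) * max 0 t ^ (m + 1)) (at t)"
      using DERIV_pow[of "m + 2" t] 1 by simp
    then show ?thesis
      by (rule has_field_derivative_transform_within_open[of _ _ _ "{0<..}"])
        (use 1 in auto)
  next
    case 2
    have "((\<lambda>t::real. 0) has_field_derivative real (m + 2) * max 0 t ^ (m + 1)) (at t)"
      using 2 by (auto simp: max_def)
    then show ?thesis
      by (rule has_field_derivative_transform_within_open[of _ _ _ "{..<0}"])
        (use 2 in \<open>auto simp: max_def\<close>)
  qed
qed

text \<open>The profile of all weighted means. It is a polynomial on the unit ball, and it is simple
  enough that the radial field \<open>bump y *\<^sub>R y\<close> has an explicit potential.\<close>

definition bump :: "'a::euclidean_space \<Rightarrow> real" where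
  "bump y = max 0 (1 - y \<bullet> y)"

lemma bump_nonneg: "0 \<le> bump y" and bump_le_1: "bump y \<le> 1"
  by (auto simp: bump_def)

lemma bump_eq_0: "bump y = 0" if "y \<notin> cball 0 1"
proof -
  have "1 < norm y" using that by simp
  then have "1 < norm y ^ 2" by (simp add: one_less_power)
  then show ?thesis by (simp add: bump_def power2_norm_eq_inner)
qed

lemma continuous_on_bump: "continuous_on S bump"
  unfolding bump_def by (intro continuous_intros)

text \<open>The square of the bump is a potential for the radial field that arises when a dilation
  is differentiated, which is what turns the derivative of a mean over dilations into a mean of
  the Laplacian.\<close>

lemma GDERIV_bump_square:
  "GDERIV (\<lambda>y. (bump y)\<^sup>2 / 4) y :> - bump y *\<^sub>R y"
proof -
  have "GDERIV (\<lambda>y. 1 - y \<bullet> y) y :> - 2 *\<^sub>R y"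
    unfolding gderiv_def by (auto intro!: derivative_eq_intros simp: inner_commute)
  moreover have "((\<lambda>t. (max 0 t)\<^sup>2 / 4) has_field_derivative max 0 t / 2) (at t)" for t :: real
    using DERIV_cdivide[OF DERIV_max_0_power[of 0 t], of 4] by (simp add: numeral_2_eq_2)
  ultimately have "GDERIV (\<lambda>y. (max 0 (1 - y \<bullet> y))\<^sup>2 / 4) y :> (max 0 (1 - y \<bullet> y) / 2) *\<^sub>R (- 2 *\<^sub>R y)"
    by (rule GDERIV_DERIV_compose)
  then show ?thesis by (simp add: bump_def)
qed

lemma integrable_continuous_bump:
  fixes w :: "'a::euclidean_space \<Rightarrow> real"
  assumes "continuous_on UNIV w"
  shows "integrable lborel (\<lambda>y. w y * bump y)"
  using assms bump_eq_0
  by (intro integrable_compact_support[of _ "cball 0 1"] continuous_intros continuous_on_bump) auto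

lemma integrable_bump: "integrable lborel (bump :: 'a::euclidean_space \<Rightarrow> real)"
  using integrable_continuous_bump[of "\<lambda>_. 1"] by simp

lemma integral_bump_pos: "0 < (LINT y|lborel. bump (y::'a::euclidean_space))"
proof -
  have "integrable lborel (\<lambda>y::'a. indicator (ball 0 (1/2)) y * (1/2::real))"
    by (intro integrable_mult_left integrable_real_indicator)
      (use emeasure_bounded_finite[OF bounded_ball[of "0::'a" "1/2"]] in auto)
  moreover have "indicator (ball 0 (1/2)) y * (1/2) \<le> bump y" for y :: 'a
  proof (cases "y \<in> ball 0 (1/2)")
    case True
    then have "norm y ^ 2 \<le> (1/2) ^ 2" by (intro power_mono) auto
    then have "y \<bullet> y \<le> (1/2)\<^sup>2" by (simp only: power2_norm_eq_inner)
    then show ?thesis using True by (simp add: bump_def power2_eq_square)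
  qed (simp add: bump_nonneg)
  ultimately have "(LINT y|lborel. indicator (ball 0 (1/2)) (y::'a) * (1/2::real))
      \<le> (LINT y|lborel. bump (y::'a))"
    using integrable_bump by (intro integral_mono) auto
  moreover have "(LINT y|lborel. indicator (ball 0 (1/2)) (y::'a) * (1/2::real))
      = measure lborel (ball (0::'a) (1/2)) / 2"
    by simp
  ultimately show ?thesis using content_ball_pos[of "1/2" "0::'a"] by linarith
qed

text \<open>For radius \<open>r\<close> let \<open>A r\<close> and \<open>E r\<close> be the weighted integrals of \<open>v\<close> and \<open>1 / v\<close> over the ball of
  radius \<open>r\<close> about \<open>x0\<close>, rescaled to the unit ball. At radius zero \<open>A\<close> is \<open>Z * v x0\<close>. Integration by
  parts gives \<open>A' r \<le> r * E r / 4\<close>, and the Cauchy--Schwarz inequality gives \<open>Z\<^sup>2 \<le> A r * E r\<close>.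
  If \<open>E r\<close> grows at most like \<open>r powr - \<gamma>\<close>, then \<open>A r\<close> is at least of order \<open>r powr \<gamma>\<close> while
  \<open>A r - A 0\<close> is at most of order \<open>r powr (2 - \<gamma>)\<close>; for \<open>\<gamma> < 1\<close> the first wins at a small radius,
  which bounds \<open>A 0\<close> from below. Here \<open>\<gamma> = 9 / 10\<close>, and writing the radius as \<open>\<rho> ^ 10\<close> keeps all
  exponents integral.

  The field \<open>W\<close> is the gradient of \<open>v\<close> and \<open>DW i\<close> the gradient of the \<open>i\<close>-th component of \<open>W\<close>, so that the sum in
  \<open>lap\<close> is the Laplacian of \<open>v\<close>.\<close>

lemma mean_value_reciprocal_lower_bound:
  fixes v :: "real^'n \<Rightarrow> real" and W :: "real^'n \<Rightarrow> real^'n"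
  defines "Z \<equiv> LINT y|lborel. bump (y :: real^'n)"
  assumes v_pos: "\<And>x. 0 < v x"
    and v: "\<And>x. GDERIV v x :> W x"
    and W: "\<And>i x. GDERIV (\<lambda>x. W x $ i) x :> DW i x"
    and DW: "\<And>i. continuous_on UNIV (\<lambda>x. DW i x $ i)"
    and lap: "\<And>x. (\<Sum>i\<in>UNIV. DW i x $ i) \<le> 1 / v x"
    and C: "0 < C"
    and recip_mean: "\<And>\<rho>. 0 < \<rho> \<Longrightarrow> \<rho> \<le> 1 \<Longrightarrow>
      (LINT y|lborel. 1 / v (x0 + \<rho> ^ 10 *\<^sub>R y) * bump y) \<le> C / \<rho> ^ 9"
  shows "3 / 4 * (Z / C) * min 1 (Z / C) ^ 9 \<le> v x0"
proof -
  define A where "A r = (LINT y|lborel. v (x0 + r *\<^sub>R y) * bump y)" for r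
  define E where "E r = (LINT y|lborel. 1 / v (x0 + r *\<^sub>R y) * bump y)" for r
  define L where "L x = (\<Sum>i\<in>UNIV. DW i x $ i)" for x
  have Z: "0 < Z" unfolding Z_def by (rule integral_bump_pos)
  have cv: "continuous_on UNIV v" using v by (rule GDERIV_imp_continuous)
  have cW: "continuous_on UNIV W"
    using continuous_on_vec_lambda[of UNIV "\<lambda>i x. W x $ i", OF GDERIV_imp_continuous[OF W]] by simp
  have cL: "continuous_on UNIV L" unfolding L_def by (intro continuous_intros DW)
  have cv': "continuous_on UNIV (\<lambda>y. v (x0 + r *\<^sub>R y))" for r
    by (intro continuous_on_compose2[OF cv] continuous_intros) auto
  have civ: "continuous_on UNIV (\<lambda>y. 1 / v (x0 + r *\<^sub>R y))" for r
    using v_pos by (intro continuous_intros cv') (auto simp: less_imp_neq[symmetric])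
  have cL': "continuous_on UNIV (\<lambda>y. L (x0 + r *\<^sub>R y))" for r
    by (intro continuous_on_compose2[OF cL] continuous_intros) auto
  obtain a b where ab: "cball (0::real^'n) 1 \<subseteq> cbox a b"
    using bounded_cball bounded_subset_cbox_symmetric by meson
  have A': "(A has_field_derivative (LINT y|lborel. (y \<bullet> W (x0 + r *\<^sub>R y)) * bump y)) (at r)" for r
    unfolding A_def
  proof (rule DERIV_integral_lborel[where a = a and b = b and U = UNIV])
    show "((\<lambda>r. v (x0 + r *\<^sub>R y) * bump y) has_field_derivative (y \<bullet> W (x0 + r *\<^sub>R y)) * bump y)
        (at r within UNIV)" for r y
      by (intro DERIV_cmult_right GDERIV_imp_directional v)
    show "continuous_on UNIV (\<lambda>y. v (x0 + r *\<^sub>R y) * bump y)" for r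
      by (intro continuous_intros continuous_on_bump cv')
    show "continuous_on (UNIV \<times> UNIV) (\<lambda>(r, y). (y \<bullet> W (x0 + r *\<^sub>R y)) * bump y)"
      unfolding case_prod_beta
      by (intro continuous_intros continuous_on_compose2[OF cW]
          continuous_on_compose2[OF continuous_on_bump[of UNIV]]) auto
    show "v (x0 + r *\<^sub>R y) * bump y = 0 \<and> (y \<bullet> W (x0 + r *\<^sub>R y)) * bump y = 0"
      if "y \<notin> cbox a b" for r y
    proof -
      have "y \<notin> cball 0 1" using that ab by blast
      then show ?thesis by (simp add: bump_eq_0 del: mem_cball)
    qed
  qed auto
  have parts: "(LINT y|lborel. (y \<bullet> W (x0 + r *\<^sub>R y)) * bump y)
      = r * (LINT y|lborel. L (x0 + r *\<^sub>R y) * ((bump y)\<^sup>2 / 4))" for r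
  proof -
    let ?p = "\<lambda>y. (bump y)\<^sup>2 / 4 :: real"
    let ?D = "\<lambda>i y. W (x0 + r *\<^sub>R y) $ i *\<^sub>R (- bump y *\<^sub>R y) + ?p y *\<^sub>R (r *\<^sub>R DW i (x0 + r *\<^sub>R y))"
    have D: "GDERIV (\<lambda>y. W (x0 + r *\<^sub>R y) $ i * ?p y) y :> ?D i y" for i y
      by (intro GDERIV_mult GDERIV_bump_square GDERIV_affine[where f = "\<lambda>x. W x $ i"] W)
    have c: "continuous_on UNIV (\<lambda>y. ?D i y $ i)" for i
      unfolding vector_add_component vector_scaleR_component
      by (intro continuous_intros continuous_on_bump continuous_on_compose2[OF cW]
          continuous_on_compose2[OF DW]) auto
    have S: "W (x0 + r *\<^sub>R y) $ i * ?p y = 0 \<and> ?D i y $ i = 0" if "y \<notin> cball 0 1" for i y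
      using bump_eq_0[OF that] by simp
    have D0: "integrable lborel (\<lambda>y. ?D i y $ i)" "(LINT y|lborel. ?D i y $ i) = 0" for i
      by (rule integral_partial_eq_0[OF D c bounded_cball[of 0 1] S], assumption)+
    have "0 = (\<Sum>i\<in>UNIV. LINT y|lborel. ?D i y $ i)" unfolding D0(2) by simp
    also have "\<dots> = (LINT y|lborel. (\<Sum>i\<in>UNIV. ?D i y $ i))"
      by (rule Bochner_Integration.integral_sum[symmetric]) (rule D0)
    also have "\<dots> = (LINT y|lborel. r * (L (x0 + r *\<^sub>R y) * ?p y) - (y \<bullet> W (x0 + r *\<^sub>R y)) * bump y)"
      by (intro Bochner_Integration.integral_cong)
        (auto simp: L_def inner_vec_def sum.distrib sum_distrib_left sum_distrib_right
          sum_subtractf[symmetric] sum_negf[symmetric] algebra_simps intro!: sum.cong)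
    also have "\<dots> = r * (LINT y|lborel. L (x0 + r *\<^sub>R y) * ?p y)
        - (LINT y|lborel. (y \<bullet> W (x0 + r *\<^sub>R y)) * bump y)"
    proof (subst Bochner_Integration.integral_diff)
      have "integrable lborel (\<lambda>y. L (x0 + r *\<^sub>R y) * ?p y)"
        using bump_eq_0
        by (intro integrable_compact_support[of _ "cball 0 1"] continuous_intros
            continuous_on_bump cL') auto
      then show "integrable lborel (\<lambda>y. r * (L (x0 + r *\<^sub>R y) * ?p y))"
        by (rule integrable_mult_right)
      show "integrable lborel (\<lambda>y. (y \<bullet> W (x0 + r *\<^sub>R y)) * bump y)"
        by (intro integrable_continuous_bump continuous_intros continuous_on_compose2[OF cW]) auto
    qed simp
    finally show ?thesis by simp
  qed
  have A'_le: "(LINT y|lborel. (y \<bullet> W (x0 + r *\<^sub>R y)) * bump y) \<le> r * E r / 4" if "0 \<le> r" for r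
  proof -
    have "(LINT y|lborel. L (x0 + r *\<^sub>R y) * ((bump y)\<^sup>2 / 4))
        \<le> (LINT y|lborel. 1 / v (x0 + r *\<^sub>R y) * bump y / 4)"
    proof (rule integral_mono)
      show "integrable lborel (\<lambda>y. L (x0 + r *\<^sub>R y) * ((bump y)\<^sup>2 / 4))"
        using bump_eq_0
        by (intro integrable_compact_support[of _ "cball 0 1"] continuous_intros
            continuous_on_bump cL') auto
      show "integrable lborel (\<lambda>y. 1 / v (x0 + r *\<^sub>R y) * bump y / 4)"
        by (intro integrable_divide integrable_continuous_bump civ)
      fix y :: "real^'n"
      have "L (x0 + r *\<^sub>R y) * ((bump y)\<^sup>2 / 4) \<le> 1 / v (x0 + r *\<^sub>R y) * ((bump y)\<^sup>2 / 4)"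
        using lap by (intro mult_right_mono) (auto simp: L_def)
      also have "(bump y)\<^sup>2 \<le> bump y"
        using bump_nonneg[of y] bump_le_1[of y] by (simp add: power2_eq_square mult_left_le)
      then have "1 / v (x0 + r *\<^sub>R y) * ((bump y)\<^sup>2 / 4) \<le> 1 / v (x0 + r *\<^sub>R y) * (bump y / 4)"
        using v_pos[of "x0 + r *\<^sub>R y"] by (intro mult_left_mono) auto
      finally show "L (x0 + r *\<^sub>R y) * ((bump y)\<^sup>2 / 4) \<le> 1 / v (x0 + r *\<^sub>R y) * bump y / 4" by simp
    qed
    also have "\<dots> = E r / 4"
      unfolding E_def by (rule integral_divide_zero)
    finally show ?thesis
      using mult_left_mono[OF _ that] unfolding parts by fastforce
  qed
  \<comment> \<open>With this radius the increase of \<open>A\<close> is at most a quarter of the Cauchy--Schwarz lower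
    bound for \<open>A (\<rho> ^ 10)\<close>.\<close>
  define \<rho> where "\<rho> = min 1 (Z / C)"
  have \<rho>: "0 < \<rho>" "\<rho> \<le> 1" "\<rho> \<le> Z / C" using Z C by (auto simp: \<rho>_def)
  have "\<exists>\<xi>>0. \<xi> < \<rho> ^ 10 \<and> A (\<rho> ^ 10) - A 0
      = (\<rho> ^ 10 - 0) * (LINT y|lborel. (y \<bullet> W (x0 + \<xi> *\<^sub>R y)) * bump y)"
    using \<rho> A' by (intro MVT2) auto
  then obtain \<xi> where \<xi>: "0 < \<xi>" "\<xi> < \<rho> ^ 10" and mvt: "A (\<rho> ^ 10) - A 0
      = \<rho> ^ 10 * (LINT y|lborel. (y \<bullet> W (x0 + \<xi> *\<^sub>R y)) * bump y)" by auto
  define \<eta> where "\<eta> = root 10 \<xi>"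
  have \<eta>: "0 < \<eta>" "\<eta> ^ 10 = \<xi>" using \<xi> by (auto simp: \<eta>_def)
  have "\<eta> \<le> \<rho>" using \<eta> \<xi> \<rho> by (metis less_eq_real_def not_less power_mono)
  have "\<xi> * E \<xi> / 4 \<le> C * \<rho> / 4"
  proof -
    have "E \<xi> \<le> C / \<eta> ^ 9" using recip_mean[of \<eta>] \<eta> \<rho> \<open>\<eta> \<le> \<rho>\<close> by (simp add: E_def)
    then have "\<xi> * E \<xi> \<le> \<eta> ^ 10 * (C / \<eta> ^ 9)"
      unfolding \<eta>(2) using \<xi> by (intro mult_left_mono) auto
    also have "\<dots> = C * \<eta>" using \<eta>(1) by (simp add: field_simps eval_nat_numeral)
    also have "\<dots> \<le> C * \<rho>" using C \<open>\<eta> \<le> \<rho>\<close> by simp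
    finally show ?thesis by simp
  qed
  then have "A (\<rho> ^ 10) - A 0 \<le> \<rho> ^ 10 * (C * \<rho> / 4)"
    unfolding mvt using A'_le[of \<xi>] \<xi> \<rho> by (intro mult_left_mono) auto
  also have "\<dots> = (C * \<rho> ^ 2) * \<rho> ^ 9 / 4" by (simp add: eval_nat_numeral)
  also have "\<dots> \<le> (Z\<^sup>2 / C) * \<rho> ^ 9 / 4"
  proof -
    have "\<rho> ^ 2 \<le> (Z / C) ^ 2" using \<rho> by (intro power_mono) auto
    then have "C * \<rho> ^ 2 \<le> Z\<^sup>2 / C" using C by (simp add: field_simps power2_eq_square)
    then show ?thesis using \<rho> by (intro divide_right_mono mult_right_mono) auto
  qed
  finally have up: "A (\<rho> ^ 10) \<le> A 0 + (Z\<^sup>2 / C) * \<rho> ^ 9 / 4" by simp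
  have low: "(Z\<^sup>2 / C) * \<rho> ^ 9 \<le> A (\<rho> ^ 10)"
  proof -
    let ?r = "\<rho> ^ 10"
    define \<tau> where "\<tau> = C / (Z * \<rho> ^ 9)"
    have \<tau>: "0 < \<tau>" using C Z \<rho> by (simp add: \<tau>_def)
    \<comment> \<open>This is the Cauchy--Schwarz inequality, written with the tangent to the reciprocal.\<close>
    have "(LINT y|lborel. 2 * \<tau> * bump y - \<tau>\<^sup>2 * (v (x0 + ?r *\<^sub>R y) * bump y)) \<le> E ?r"
      unfolding E_def
    proof (rule integral_mono)
      show "integrable lborel (\<lambda>y. 2 * \<tau> * bump y - \<tau>\<^sup>2 * (v (x0 + ?r *\<^sub>R y) * bump y))"
        by (intro Bochner_Integration.integrable_diff integrable_mult_right integrable_bump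
            integrable_continuous_bump cv')
      show "integrable lborel (\<lambda>y. 1 / v (x0 + ?r *\<^sub>R y) * bump y)"
        by (rule integrable_continuous_bump[OF civ])
      fix y :: "real^'n"
      let ?s = "v (x0 + ?r *\<^sub>R y)"
      have "0 \<le> (1 - \<tau> * ?s)\<^sup>2 / ?s" using v_pos[of "x0 + ?r *\<^sub>R y"] by simp
      then have "2 * \<tau> - \<tau>\<^sup>2 * ?s \<le> 1 / ?s"
        using v_pos[of "x0 + ?r *\<^sub>R y"]
        by (simp add: power2_eq_square diff_divide_distrib algebra_simps add_divide_distrib)
      from mult_right_mono[OF this bump_nonneg[of y]]
      show "2 * \<tau> * bump y - \<tau>\<^sup>2 * (?s * bump y) \<le> 1 / ?s * bump y"
        by (simp add: algebra_simps)
    qed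
    also have "(LINT y|lborel. 2 * \<tau> * bump y - \<tau>\<^sup>2 * (v (x0 + ?r *\<^sub>R y) * bump y))
        = 2 * \<tau> * Z - \<tau>\<^sup>2 * A ?r"
      unfolding Z_def A_def
      by (subst Bochner_Integration.integral_diff)
        (auto intro!: integrable_mult_right integrable_bump integrable_continuous_bump cv'
          simp del: integrable_mult_right_iff)
    finally have "2 * \<tau> * Z - \<tau>\<^sup>2 * A ?r \<le> C / \<rho> ^ 9"
      using recip_mean[of \<rho>] \<rho> by (simp add: E_def)
    moreover have "\<tau> * Z = C / \<rho> ^ 9" using Z by (simp add: \<tau>_def)
    ultimately have "\<tau> * Z \<le> \<tau> * (\<tau> * A ?r)" by (simp add: power2_eq_square algebra_simps)
    then have "Z \<le> \<tau> * A ?r" using \<tau> by (simp only: mult_le_cancel_left_pos)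
    then show ?thesis using C Z \<rho> by (simp add: \<tau>_def field_simps power2_eq_square)
  qed
  have "A 0 = Z * v x0" by (simp add: A_def Z_def)
  then have "3 / 4 * (Z\<^sup>2 / C) * \<rho> ^ 9 \<le> Z * v x0" using up low by simp
  then have "Z * (3 / 4 * (Z / C) * \<rho> ^ 9) \<le> Z * v x0" by (simp add: power2_eq_square algebra_simps)
  then show ?thesis using Z unfolding \<rho>_def[symmetric] by (simp only: mult_le_cancel_left_pos)
qed

section \<open>Gradients and extension by a constant\<close>

lemma differentiable_imp_GDERIV:
  fixes f :: "real^'n \<Rightarrow> real"
  assumes "f differentiable (at x)"
  shows "GDERIV f x :> grad f x"
proof -
  obtain f' where f': "(f has_derivative f') (at x)"
    using assms unfolding differentiable_def by blast
  interpret linear f' using f' by (rule has_derivative_linear)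
  have p: "partial_deriv i f x = f' (axis i 1)" for i
  proof -
    have "((\<lambda>t. f (x + t *\<^sub>R axis i 1)) has_derivative (\<lambda>t. f' (t *\<^sub>R axis i 1))) (at 0)"
      by (rule has_derivative_compose[where f = "\<lambda>t. x + t *\<^sub>R axis i 1" and g = f])
        (use f' in \<open>auto intro!: derivative_eq_intros\<close>)
    then have "((\<lambda>t. f (x + t *\<^sub>R axis i 1)) has_field_derivative f' (axis i 1)) (at 0)"
      by (simp add: has_field_derivative_def scaleR mult_commute_abs)
    then show ?thesis unfolding partial_deriv_def by (rule DERIV_imp_deriv)
  qed
  have "f' h = h \<bullet> grad f x" for h
  proof -
    have "f' h = f' (\<Sum>i\<in>UNIV. h $ i *\<^sub>R axis i 1)"
      by (simp add: basis_expansion[of h] scalar_mult_eq_scaleR[symmetric])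
    also have "\<dots> = (\<Sum>i\<in>UNIV. h $ i * f' (axis i 1))" by (simp add: sum scaleR)
    finally show ?thesis by (simp add: inner_vec_def grad_def p)
  qed
  then have "f' = (\<lambda>h. h \<bullet> grad f x)" by blast
  with f' show ?thesis by (simp add: gderiv_def)
qed

lemma GDERIV_imp_grad:
  fixes f :: "real^'n \<Rightarrow> real"
  assumes "GDERIV f x :> D"
  shows "grad f x = D" and "partial_deriv i f x = D $ i"
proof -
  have *: "partial_deriv i f x = D $ i" for i
    unfolding partial_deriv_def
    using GDERIV_imp_directional[of f x 0 "axis i 1" D UNIV] assms
    by (intro DERIV_imp_deriv) (simp add: inner_axis')
  then show "partial_deriv i f x = D $ i" .
  show "grad f x = D" by (simp add: grad_def * vec_eq_iff)
qed

lemma GDERIV_extend_const: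
  fixes f :: "'a::real_inner \<Rightarrow> real"
  assumes \<Omega>: "open \<Omega>" and K: "closed K" "K \<subseteq> \<Omega>"
    and f: "\<And>x. x \<in> \<Omega> \<Longrightarrow> GDERIV f x :> D x" "\<And>x. x \<in> \<Omega> - K \<Longrightarrow> f x = c"
  shows "GDERIV (\<lambda>x. if x \<in> \<Omega> then f x else c) x :> (if x \<in> \<Omega> then D x else 0)"
proof (cases "x \<in> \<Omega>")
  case True
  have "(f has_derivative (\<lambda>h. h \<bullet> D x)) (at x)" using f(1)[OF True] by (simp add: gderiv_def)
  then have "((\<lambda>x. if x \<in> \<Omega> then f x else c) has_derivative (\<lambda>h. h \<bullet> D x)) (at x)"
    by (rule has_derivative_transform_within_open[OF _ \<Omega> True]) simp
  then show ?thesis using True by (simp add: gderiv_def)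
next
  case False
  have "((\<lambda>x. c) has_derivative (\<lambda>h. 0)) (at x)" by simp
  then have "((\<lambda>x. if x \<in> \<Omega> then f x else c) has_derivative (\<lambda>h. 0)) (at x)"
    by (rule has_derivative_transform_within_open[of _ _ _ _ "- K"])
      (use False K f(2) in \<open>auto simp: open_Compl\<close>)
  then show ?thesis using False by (simp add: gderiv_def)
qed

lemma continuous_on_extend_0:
  fixes f :: "'a::topological_space \<Rightarrow> 'b::real_normed_vector"
  assumes \<Omega>: "open \<Omega>" and K: "closed K" "K \<subseteq> \<Omega>"
    and f: "continuous_on \<Omega> f" "\<And>x. x \<in> \<Omega> - K \<Longrightarrow> f x = 0"
  shows "continuous_on UNIV (\<lambda>x. if x \<in> \<Omega> then f x else 0)"
proof -
  have "continuous_on (\<Omega> \<union> - K) (\<lambda>x. if x \<in> \<Omega> then f x else 0)"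
  proof (rule continuous_on_open_Un)
    show "continuous_on \<Omega> (\<lambda>x. if x \<in> \<Omega> then f x else 0)"
      using f(1) by (rule continuous_on_eq) simp
    have "continuous_on (- K) (\<lambda>x. 0 :: 'b)" by simp
    then show "continuous_on (- K) (\<lambda>x. if x \<in> \<Omega> then f x else 0)"
      by (rule continuous_on_eq) (use f(2) in auto)
  qed (use \<Omega> K in \<open>auto simp: open_Compl\<close>)
  moreover have "\<Omega> \<union> - K = UNIV" using K by auto
  ultimately show ?thesis by simp
qed

section \<open>Truncations of the solution\<close>

text \<open>Since \<open>u\<close> exceeds \<open>k\<close> on the frontier, the sublevel set \<open>K\<close> is a compact subset of \<open>\<Omega>\<close>. Hence a
  function of \<open>u\<close> that vanishes above level \<open>k\<close> has compact support, and all estimates below are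
  global on \<open>\<Omega>\<close>.\<close>

locale dirichlet_solution =
  fixes \<Omega> :: "(real^'n) set" and u :: "real^'n \<Rightarrow> real" and k :: real
  assumes open_\<Omega>: "open \<Omega>" and bounded_\<Omega>: "bounded \<Omega>"
    and u_pos: "\<And>x. x \<in> \<Omega> \<Longrightarrow> 0 < u x"
    and u_cont: "continuous_on (closure \<Omega>) u"
    and u_C2: "Ck_on 2 \<Omega> u"
    and u_lap: "\<And>x. x \<in> \<Omega> \<Longrightarrow> laplacian u x = 1 / u x"
    and k_pos: "0 < k"
    and u_boundary: "\<And>x. x \<in> frontier \<Omega> \<Longrightarrow> k < u x"
begin

definition K where "K = {x \<in> \<Omega>. u x \<le> k}"

lemma compact_K: "compact K"
proof -
  have "K = {x \<in> closure \<Omega>. u x \<le> k}"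
    using u_boundary closure_subset[of \<Omega>] open_\<Omega>
    by (fastforce simp: K_def frontier_def interior_open)
  moreover have "closed {x \<in> closure \<Omega>. u x \<le> k}"
    using u_cont by (intro continuous_on_closed_Collect_le) auto
  moreover have "bounded K" using bounded_\<Omega> by (rule bounded_subset) (auto simp: K_def)
  ultimately show ?thesis by (simp add: compact_eq_bounded_closed)
qed

lemma closed_K: "closed K" and K_subset: "K \<subseteq> \<Omega>"
  using compact_K by (auto simp: K_def compact_imp_closed)

lemma off_K: "x \<in> \<Omega> - K \<Longrightarrow> k < u x"
  by (auto simp: K_def)

lemma
  shows differentiable_u: "u differentiable_on \<Omega>"
    and differentiable_partial_u: "partial_deriv i u differentiable_on \<Omega>"
    and continuous_partial2: "continuous_on \<Omega> (partial_deriv j (partial_deriv i u))"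
  using u_C2 by (simp_all add: numeral_2_eq_2)

lemma GDERIV_u: "x \<in> \<Omega> \<Longrightarrow> GDERIV u x :> grad u x"
  using differentiable_u open_\<Omega>
  by (simp add: differentiable_on_eq_differentiable_at differentiable_imp_GDERIV)

lemma GDERIV_partial_u:
  "x \<in> \<Omega> \<Longrightarrow> GDERIV (partial_deriv i u) x :> grad (partial_deriv i u) x"
  using differentiable_partial_u open_\<Omega>
  by (simp add: differentiable_on_eq_differentiable_at differentiable_imp_GDERIV)

lemma continuous_u: "continuous_on \<Omega> u"
  and continuous_partial: "continuous_on \<Omega> (partial_deriv i u)"
  by (rule differentiable_imp_continuous_on, rule differentiable_u differentiable_partial_u)+

lemma continuous_grad: "continuous_on \<Omega> (grad u)"
  unfolding grad_def by (intro continuous_on_vec_lambda continuous_partial)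

definition extend0 :: "(real^'n \<Rightarrow> 'b::real_normed_vector) \<Rightarrow> real^'n \<Rightarrow> 'b" where
  "extend0 f x = (if x \<in> \<Omega> then f x else 0)"

lemma integrable_extend0:
  assumes "continuous_on \<Omega> f" "\<And>x. x \<in> \<Omega> - K \<Longrightarrow> f x = 0"
  shows "integrable lborel (extend0 f :: _ \<Rightarrow> real)"
  unfolding extend0_def
  by (rule integrable_compact_support[OF continuous_on_extend_0[OF open_\<Omega> closed_K K_subset assms]
        compact_K]) (use assms in auto)

lemma set_lebesgue_integral_extend0:
  "(LINT x:\<Omega>|lborel. f x) = (LINT x|lborel. extend0 f x :: real)"
  unfolding set_lebesgue_integral_def extend0_def
  by (intro Bochner_Integration.integral_cong) (auto simp: indicator_def)

text \<open>The field \<open>\<psi> (u x) *\<^sub>R grad u x\<close>, extended by zero, serves twice: with \<open>\<psi>\<close> a power of \<open>1 / u\<close> cut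
  off at \<open>k\<close> it yields the energy identity, and with \<open>\<psi>\<close> the derivative of a concave function it is
  the gradient of the truncated solution. By the equation its divergence is \<open>flux_div\<close>.\<close>

definition flux where "flux \<psi> = extend0 (\<lambda>x. \<psi> (u x) *\<^sub>R grad u x)"

definition flux_grad where "flux_grad \<psi> \<psi>' i = extend0 (\<lambda>x.
  \<psi> (u x) *\<^sub>R grad (partial_deriv i u) x + partial_deriv i u x *\<^sub>R (\<psi>' (u x) *\<^sub>R grad u x))"

definition flux_div where "flux_div \<psi> \<psi>' = extend0 (\<lambda>x.
  \<psi> (u x) / u x + \<psi>' (u x) * (norm (grad u x))\<^sup>2)"

definition cutoff where
  "cutoff \<psi> \<psi>' \<longleftrightarrow> (\<forall>t>0. (\<psi> has_field_derivative \<psi>' t) (at t)) \<and> continuous_on {0<..} \<psi>'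
     \<and> (\<forall>t>k. \<psi> t = 0 \<and> \<psi>' t = (0::real))"

lemma
  assumes "cutoff \<psi> \<psi>'"
  shows cutoffD: "\<And>t. 0 < t \<Longrightarrow> (\<psi> has_field_derivative \<psi>' t) (at t)"
    and cutoff_cont': "continuous_on \<Omega> (\<lambda>x. \<psi>' (u x))"
    and cutoff_0: "\<And>x. x \<in> \<Omega> - K \<Longrightarrow> \<psi> (u x) = 0 \<and> \<psi>' (u x) = 0"
    and cutoff_cont: "continuous_on \<Omega> (\<lambda>x. \<psi> (u x))"
proof -
  show D: "(\<psi> has_field_derivative \<psi>' t) (at t)" if "0 < t" for t
    using assms that by (auto simp: cutoff_def)
  show "continuous_on \<Omega> (\<lambda>x. \<psi>' (u x))"
    using assms u_pos by (intro continuous_on_compose2[OF _ continuous_u]) (auto simp: cutoff_def)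
  show "\<psi> (u x) = 0 \<and> \<psi>' (u x) = 0" if "x \<in> \<Omega> - K" for x
    using assms off_K[OF that] by (auto simp: cutoff_def)
  have "continuous_on {0<..} \<psi>" by (intro DERIV_continuous_on[of _ _ \<psi>'] DERIV_subset[OF D]) auto
  then show "continuous_on \<Omega> (\<lambda>x. \<psi> (u x))"
    using u_pos by (intro continuous_on_compose2[OF _ continuous_u]) auto
qed

context
  fixes \<psi> \<psi>' assumes \<psi>: "cutoff \<psi> \<psi>'"
begin

lemma GDERIV_flux: "GDERIV (\<lambda>x. flux \<psi> x $ i) x :> flux_grad \<psi> \<psi>' i x"
proof -
  have "GDERIV (\<lambda>x. \<psi> (u x) * partial_deriv i u x) x :> \<psi> (u x) *\<^sub>R grad (partial_deriv i u) x
      + partial_deriv i u x *\<^sub>R (\<psi>' (u x) *\<^sub>R grad u x)" if "x \<in> \<Omega>" for x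
    using that by (intro GDERIV_mult GDERIV_DERIV_compose GDERIV_u GDERIV_partial_u cutoffD[OF \<psi>] u_pos)
  then have "GDERIV (\<lambda>x. if x \<in> \<Omega> then \<psi> (u x) * partial_deriv i u x else 0) x :> flux_grad \<psi> \<psi>' i x"
    unfolding flux_grad_def extend0_def
    by (rule GDERIV_extend_const[OF open_\<Omega> closed_K K_subset]) (use cutoff_0[OF \<psi>] in auto)
  moreover have "(\<lambda>x. flux \<psi> x $ i) = (\<lambda>x. if x \<in> \<Omega> then \<psi> (u x) * partial_deriv i u x else 0)"
    by (auto simp: flux_def extend0_def grad_def)
  ultimately show ?thesis by simp
qed

lemma continuous_flux_grad: "continuous_on UNIV (\<lambda>x. flux_grad \<psi> \<psi>' i x $ i)"
proof -
  have "continuous_on UNIV (\<lambda>x. if x \<in> \<Omega> then \<psi> (u x) * partial_deriv i (partial_deriv i u) x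
      + partial_deriv i u x * (\<psi>' (u x) * partial_deriv i u x) else 0)"
    by (rule continuous_on_extend_0[OF open_\<Omega> closed_K K_subset])
      (auto intro!: continuous_intros cutoff_cont[OF \<psi>] cutoff_cont'[OF \<psi>] continuous_partial
        continuous_partial2 simp: cutoff_0[OF \<psi>])
  then show ?thesis
    by (rule continuous_on_eq) (auto simp: flux_grad_def extend0_def grad_def)
qed

lemma flux_off_K: "x \<notin> K \<Longrightarrow> flux \<psi> x = 0 \<and> flux_grad \<psi> \<psi>' i x = 0"
  using cutoff_0[OF \<psi>] by (auto simp: flux_def flux_grad_def extend0_def)

lemma flux_div: "(\<Sum>i\<in>UNIV. flux_grad \<psi> \<psi>' i x $ i) = flux_div \<psi> \<psi>' x"
proof (cases "x \<in> \<Omega>")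
  case True
  have "(\<Sum>i\<in>UNIV. flux_grad \<psi> \<psi>' i x $ i)
      = \<psi> (u x) * laplacian u x + \<psi>' (u x) * (grad u x \<bullet> grad u x)"
    using True
    by (simp add: flux_grad_def extend0_def laplacian_def grad_def inner_vec_def sum.distrib
        sum_distrib_left mult_ac)
  then show ?thesis
    using True u_lap by (simp add: flux_div_def extend0_def power2_norm_eq_inner)
qed (simp add: flux_grad_def flux_div_def extend0_def)

text \<open>The flux has compact support, so its divergence integrates to zero: the equation has been
  multiplied by \<open>\<psi> (u x)\<close> and integrated by parts.\<close>

lemma energy_identity:
  "(LINT x:\<Omega>|lborel. - \<psi>' (u x) * (norm (grad u x))\<^sup>2) = (LINT x:\<Omega>|lborel. \<psi> (u x) / u x)"
proof -
  have i1: "integrable lborel (extend0 (\<lambda>x. - \<psi>' (u x) * (norm (grad u x))\<^sup>2))"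
    by (intro integrable_extend0 continuous_intros cutoff_cont'[OF \<psi>] continuous_grad)
      (auto simp: cutoff_0[OF \<psi>])
  have i2: "integrable lborel (extend0 (\<lambda>x. \<psi> (u x) / u x))"
    using u_pos
    by (intro integrable_extend0 continuous_intros cutoff_cont[OF \<psi>] continuous_u)
      (auto simp: cutoff_0[OF \<psi>] less_imp_neq[symmetric])
  have z: "flux \<psi> x $ i = 0 \<and> flux_grad \<psi> \<psi>' i x $ i = 0" if "x \<notin> K" for x i
    using flux_off_K[OF that] by simp
  have D0: "integrable lborel (\<lambda>x. flux_grad \<psi> \<psi>' i x $ i)"
      "(LINT x|lborel. flux_grad \<psi> \<psi>' i x $ i) = 0" for i
    by (rule integral_partial_eq_0[OF GDERIV_flux continuous_flux_grad
          compact_imp_bounded[OF compact_K] z], assumption)+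
  have "0 = (\<Sum>i\<in>UNIV. LINT x|lborel. flux_grad \<psi> \<psi>' i x $ i)" unfolding D0(2) by simp
  also have "\<dots> = (LINT x|lborel. flux_div \<psi> \<psi>' x)"
    unfolding flux_div[symmetric] by (rule Bochner_Integration.integral_sum[symmetric]) (rule D0)
  also have "\<dots> = (LINT x|lborel. extend0 (\<lambda>x. \<psi> (u x) / u x) x
      - extend0 (\<lambda>x. - \<psi>' (u x) * (norm (grad u x))\<^sup>2) x)"
    by (intro Bochner_Integration.integral_cong) (auto simp: flux_div_def extend0_def)
  also have "\<dots> = (LINT x|lborel. extend0 (\<lambda>x. \<psi> (u x) / u x) x)
      - (LINT x|lborel. extend0 (\<lambda>x. - \<psi>' (u x) * (norm (grad u x))\<^sup>2) x)"
    by (rule Bochner_Integration.integral_diff[OF i2 i1])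
  finally show ?thesis by (simp add: set_lebesgue_integral_extend0)
qed

lemma
  shows GDERIV_cutoff: "x \<in> \<Omega> \<Longrightarrow> GDERIV (\<lambda>x. \<psi> (u x)) x :> \<psi>' (u x) *\<^sub>R grad u x"
    and test_function_cutoff: "test_function \<Omega> (\<lambda>x. \<psi> (u x))"
proof -
  show D: "GDERIV (\<lambda>x. \<psi> (u x)) x :> \<psi>' (u x) *\<^sub>R grad u x" if "x \<in> \<Omega>" for x
    using that by (intro GDERIV_DERIV_compose GDERIV_u cutoffD[OF \<psi>] u_pos)
  have "continuous_on \<Omega> (partial_deriv i (\<lambda>x. \<psi> (u x)))" for i
  proof -
    have "continuous_on \<Omega> (\<lambda>x. \<psi>' (u x) * partial_deriv i u x)"
      by (intro continuous_intros cutoff_cont'[OF \<psi>] continuous_partial)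
    then show ?thesis
      by (rule continuous_on_eq) (simp add: GDERIV_imp_grad(2)[OF D] grad_def)
  qed
  moreover have "(\<lambda>x. \<psi> (u x)) differentiable_on \<Omega>"
    using D unfolding gderiv_def differentiable_on_def
    by (meson differentiableI differentiable_at_withinI)
  ultimately show "test_function \<Omega> (\<lambda>x. \<psi> (u x))"
    using compact_K K_subset cutoff_0[OF \<psi>] by (auto simp: test_function_def)
qed

end

end

section \<open>Reciprocal powers of the solution\<close>

text \<open>The argument uses the powers \<open>u powr - 7 / 6\<close>, \<open>u powr - 17 / 6\<close> and \<open>u powr - 20 / 3\<close>; in terms of
  the sixth root of \<open>1 / u\<close> all of them have natural exponents.\<close>

definition rec6 :: "real \<Rightarrow> real" where
  "rec6 t = t powr (- 1 / 6)"

lemma rec6_pos: "0 < t \<Longrightarrow> 0 < rec6 t"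
  by (simp add: rec6_def)

lemma rec6_power6: "0 < t \<Longrightarrow> rec6 t ^ 6 = 1 / t"
  unfolding rec6_def by (subst powr_power) (auto simp: powr_minus_divide)

lemma rec6_strict_antimono: "0 < s \<Longrightarrow> s < t \<Longrightarrow> rec6 t < rec6 s"
  by (simp add: rec6_def powr_less_mono2_neg)

lemma rec6_antimono: "0 < s \<Longrightarrow> s \<le> t \<Longrightarrow> rec6 t \<le> rec6 s"
  using rec6_strict_antimono[of s t] by (cases "s = t") auto

lemma continuous_on_rec6: "continuous_on {0<..} rec6"
  unfolding rec6_def by (intro continuous_intros) auto

lemma DERIV_rec6: "0 < t \<Longrightarrow> (rec6 has_field_derivative - (rec6 t ^ 7 / 6)) (at t)"
  using has_real_derivative_powr[of t "- 1 / 6"]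
  by (simp add: rec6_def[abs_def] powr_power)

definition rec6_cut :: "real \<Rightarrow> nat \<Rightarrow> real \<Rightarrow> real" where
  "rec6_cut k n t = (max 0 (rec6 t ^ n - rec6 k ^ n))\<^sup>2"

definition rec6_cut_deriv :: "real \<Rightarrow> nat \<Rightarrow> real \<Rightarrow> real" where
  "rec6_cut_deriv k n t = - (real n / 3 * max 0 (rec6 t ^ n - rec6 k ^ n) * rec6 t ^ (n + 6))"

lemma DERIV_rec6_cut:
  assumes "0 < t" "0 < n"
  shows "(rec6_cut k n has_field_derivative rec6_cut_deriv k n t) (at t)"
proof -
  obtain m where n: "n = Suc m" using \<open>0 < n\<close> by (cases n) auto
  have 1: "((\<lambda>t. rec6 t ^ n - rec6 k ^ n) has_field_derivative
      real n * (- (rec6 t ^ 7 / 6)) * rec6 t ^ m) (at t)"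
    using DERIV_diff[OF DERIV_power[OF DERIV_rec6[OF assms(1)], of n] DERIV_const[of "rec6 k ^ n"]]
    by (simp add: n mult_ac)
  have "((\<lambda>t. (max 0 (rec6 t ^ n - rec6 k ^ n))\<^sup>2) has_field_derivative
      (2 * max 0 (rec6 t ^ n - rec6 k ^ n)) * (real n * (- (rec6 t ^ 7 / 6)) * rec6 t ^ m)) (at t)"
    using DERIV_chain2[OF DERIV_max_0_power[of 0] 1] by (simp add: numeral_2_eq_2)
  moreover have "(2 * max 0 (rec6 t ^ n - rec6 k ^ n)) * (real n * (- (rec6 t ^ 7 / 6)) * rec6 t ^ m)
      = rec6_cut_deriv k n t"
    unfolding rec6_cut_deriv_def n by (simp add: eval_nat_numeral mult_ac)
  ultimately show ?thesis unfolding rec6_cut_def[abs_def] by simp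
qed

context dirichlet_solution
begin

lemma cutoff_rec6:
  assumes "0 < n"
  shows "cutoff (\<lambda>t. c * rec6_cut k n t) (\<lambda>t. c * rec6_cut_deriv k n t)"
  unfolding cutoff_def
proof (intro conjI allI impI)
  show "((\<lambda>t. c * rec6_cut k n t) has_field_derivative c * rec6_cut_deriv k n t) (at t)"
    if "0 < t" for t
    using DERIV_rec6_cut[OF that assms] by (rule DERIV_cmult)
  show "continuous_on {0<..} (\<lambda>t. c * rec6_cut_deriv k n t)"
    unfolding rec6_cut_deriv_def by (intro continuous_intros continuous_on_rec6)
  show "c * rec6_cut k n t = 0" "c * rec6_cut_deriv k n t = 0" if "k < t" for t
  proof -
    have "rec6 t ^ n \<le> rec6 k ^ n"
      using that k_pos rec6_antimono[of k t] rec6_pos[of t] by (intro power_mono) auto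
    then show "c * rec6_cut k n t = 0" "c * rec6_cut_deriv k n t = 0"
      by (auto simp: rec6_cut_def rec6_cut_deriv_def)
  qed
qed

text \<open>The functions \<open>(s ^ 7 - \<kappa> ^ 7)\<^sup>2\<close> and \<open>49 / 51 * (s ^ 17 - \<kappa> ^ 17)\<^sup>2\<close>, where \<open>s\<close> is the sixth root
  of \<open>1 / t\<close>, play the roles of the test function \<open>F\<close> in the stability inequality and of the
  multiplier \<open>\<psi>\<close> in the energy identity. The factor \<open>49 / 51\<close> makes the leading terms of \<open>F'\<^sup>2\<close> and
  \<open>- \<psi>'\<close> equal, and the cut-offs are matched so that the inequality also holds between the full
  expressions.\<close>

lemma rec6_cut_deriv_square_le:
  assumes "0 < t"
  shows "(rec6_cut_deriv k 7 t)\<^sup>2 \<le> - (49 / 51 * rec6_cut_deriv k 17 t)"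
proof -
  define s \<kappa> where "s = rec6 t" and "\<kappa> = rec6 k"
  have pos: "0 < s" "0 < \<kappa>" using assms k_pos rec6_pos by (auto simp: s_def \<kappa>_def)
  have key: "s ^ 3 * (max 0 (s ^ 7 - \<kappa> ^ 7))\<^sup>2 \<le> max 0 (s ^ 17 - \<kappa> ^ 17)"
  proof (cases "\<kappa> \<le> s")
    case True
    have le: "\<kappa> ^ n \<le> s ^ n" for n using True pos by (intro power_mono) auto
    have "(s ^ 7 - \<kappa> ^ 7)\<^sup>2 \<le> (s ^ 7 - \<kappa> ^ 7) * (s ^ 7 + \<kappa> ^ 7)"
      unfolding power2_eq_square using le[of 7] pos by (intro mult_left_mono) auto
    also have "\<dots> = s ^ 14 - \<kappa> ^ 14" by (simp add: algebra_simps flip: power_add)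
    finally have "s ^ 3 * (s ^ 7 - \<kappa> ^ 7)\<^sup>2 \<le> s ^ 3 * (s ^ 14 - \<kappa> ^ 14)"
      using pos by (intro mult_left_mono) auto
    also have "\<dots> = s ^ 17 - s ^ 3 * \<kappa> ^ 14" by (simp add: algebra_simps flip: power_add)
    also have "\<dots> \<le> s ^ 17 - \<kappa> ^ 3 * \<kappa> ^ 14"
      using le[of 3] pos by (intro diff_left_mono mult_right_mono) auto
    also have "\<dots> = s ^ 17 - \<kappa> ^ 17" by (simp flip: power_add)
    finally show ?thesis using le[of 7] le[of 17] by simp
  next
    case False
    then have "s ^ 7 \<le> \<kappa> ^ 7" using pos by (intro power_mono) auto
    then show ?thesis by simp
  qed
  have "(rec6_cut_deriv k 7 t)\<^sup>2 = 49 / 9 * s ^ 23 * (s ^ 3 * (max 0 (s ^ 7 - \<kappa> ^ 7))\<^sup>2)"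
    unfolding rec6_cut_deriv_def s_def[symmetric] \<kappa>_def[symmetric]
    by (simp add: power_mult_distrib power_divide flip: power_mult power_add)
  also have "\<dots> \<le> 49 / 9 * s ^ 23 * max 0 (s ^ 17 - \<kappa> ^ 17)"
    using key pos by (intro mult_left_mono) auto
  also have "\<dots> = - (49 / 51 * rec6_cut_deriv k 17 t)"
    unfolding rec6_cut_deriv_def s_def[symmetric] \<kappa>_def[symmetric] by simp
  finally show ?thesis .
qed

text \<open>Combined with the energy identity, stability says that the integral of the right-hand side
  over \<open>\<Omega>\<close> is at most zero. Its leading term in \<open>s\<close>, the sixth root of \<open>1 / t\<close>, is
  \<open>(1 - 49 / 51) * s ^ 40\<close>. For \<open>F = u powr - q\<close> the corresponding factor is
  \<open>1 - q\<^sup>2 / (2 * q + 1)\<close>, which is positive precisely for \<open>q < 1 + sqrt 2\<close>; here \<open>q = 7 / 3\<close>, and the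
  power of \<open>1 / u\<close> under control is \<open>2 * q + 2 = 20 / 3\<close>, larger than six. Half of the leading
  term absorbs the error from the cut-off wherever \<open>s\<close> is large compared with \<open>\<kappa>\<close>.\<close>

lemma rec6_cut_gap:
  assumes "0 < t" "t \<le> k"
  shows "rec6 t ^ 40 / 51 - (204 * rec6 k) ^ 40
    \<le> (rec6_cut k 7 t)\<^sup>2 / t\<^sup>2 - 49 / 51 * rec6_cut k 17 t / t"
proof -
  define s \<kappa> where "s = rec6 t" and "\<kappa> = rec6 k"
  have pos: "0 < \<kappa>" "\<kappa> \<le> s" using assms rec6_pos rec6_antimono by (auto simp: s_def \<kappa>_def)
  have le: "\<kappa> ^ n \<le> s ^ n" for n using pos by (intro power_mono) auto
  have t: "1 / t = s ^ 6" using rec6_power6[OF assms(1)] by (simp add: s_def)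
  have "(rec6_cut k 17 t) / t = (s ^ 17 - \<kappa> ^ 17)\<^sup>2 * s ^ 6"
    using le[of 17] t unfolding rec6_cut_def s_def[symmetric] \<kappa>_def[symmetric]
    by (simp add: divide_inverse)
  also have "\<dots> \<le> (s ^ 17)\<^sup>2 * s ^ 6"
    using le[of 17] pos by (intro mult_right_mono power_mono) auto
  also have "\<dots> = s ^ 40" by (simp flip: power_mult power_add)
  finally have up: "49 / 51 * rec6_cut k 17 t / t \<le> 49 / 51 * s ^ 40" by simp
  have eq: "(rec6_cut k 7 t)\<^sup>2 / t\<^sup>2 = (s ^ 7 - \<kappa> ^ 7) ^ 4 * s ^ 12"
  proof -
    have "(rec6_cut k 7 t)\<^sup>2 / t\<^sup>2 = ((s ^ 7 - \<kappa> ^ 7)\<^sup>2)\<^sup>2 * (1 / t)\<^sup>2"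
      using le[of 7] unfolding rec6_cut_def s_def[symmetric] \<kappa>_def[symmetric]
      by (simp add: power_divide)
    then show ?thesis unfolding t by (simp flip: power_mult)
  qed
  have low: "50 / 51 * s ^ 40 - (204 * \<kappa>) ^ 40 \<le> (s ^ 7 - \<kappa> ^ 7) ^ 4 * s ^ 12"
  proof (cases "204 * \<kappa> ^ 7 \<le> s ^ 7")
    case True
    define x d where "x = s ^ 7" and "d = \<kappa> ^ 7"
    have xd: "0 \<le> d" "204 * d \<le> x" using True pos by (auto simp: x_def d_def)
    have "50 / 51 * x ^ 4 \<le> x ^ 4 - 4 * d * x ^ 3"
      using mult_right_mono[OF xd(2), of "x ^ 3"] xd by (simp add: eval_nat_numeral)
    also have "\<dots> \<le> (x - d) ^ 4"
    proof -
      have "0 \<le> d\<^sup>2 * (2 * x * (3 * x - 2 * d)) + d ^ 4" using xd by (intro add_nonneg_nonneg mult_nonneg_nonneg) auto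
      also have "\<dots> = (x - d) ^ 4 - (x ^ 4 - 4 * d * x ^ 3)"
        by (simp add: eval_nat_numeral algebra_simps)
      finally show ?thesis by simp
    qed
    finally have "50 / 51 * x ^ 4 * s ^ 12 \<le> (x - d) ^ 4 * s ^ 12"
      using pos by (intro mult_right_mono) auto
    moreover have "x ^ 4 * s ^ 12 = s ^ 40" by (simp add: x_def flip: power_mult power_add)
    moreover have "0 \<le> (204 * \<kappa>) ^ 40" using pos by simp
    ultimately show ?thesis unfolding x_def d_def mult.assoc by linarith
  next
    case False
    then have "s ^ 7 < 204 * \<kappa> ^ 7" by simp
    also have "\<dots> \<le> 204 ^ 7 * \<kappa> ^ 7" using pos by (intro mult_right_mono) auto
    also have "\<dots> = (204 * \<kappa>) ^ 7" by (rule power_mult_distrib[symmetric])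
    finally have "s < 204 * \<kappa>" using pos by (rule_tac power_less_imp_less_base[of s 7]) auto
    then have "s ^ 40 \<le> (204 * \<kappa>) ^ 40" using pos by (intro power_mono) auto
    moreover have "0 \<le> s ^ 40" "0 \<le> (s ^ 7 - \<kappa> ^ 7) ^ 4 * s ^ 12" using pos le[of 7] by auto
    ultimately show ?thesis by linarith
  qed
  show ?thesis using up low unfolding eq s_def[symmetric] \<kappa>_def[symmetric] by linarith
qed

definition rec_moment where "rec_moment = (LINT x|lborel. indicator K x * rec6 (u x) ^ 40)"

lemma integrable_rec6: "integrable lborel (\<lambda>x. indicator K x * rec6 (u x) ^ 40)"
proof -
  have "continuous_on K (\<lambda>x. rec6 (u x) ^ 40)"
    using K_subset u_pos
    by (intro continuous_intros continuous_on_compose2[OF continuous_on_rec6]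
        continuous_on_subset[OF continuous_u]) auto
  from borel_integrable_compact[OF compact_K this] show ?thesis by simp
qed

text \<open>Stability tested with a cut-off power of \<open>1 / u\<close> is compared with the equation tested with
  another such power. The gradient terms cancel, and what remains controls the integral of
  \<open>u powr - 20 / 3\<close> over \<open>K\<close>.\<close>

lemma reciprocal_power_bound:
  assumes "stable \<Omega> u"
  shows "rec_moment \<le> 51 * (204 * rec6 k) ^ 40 * measure lborel \<Omega>"
proof -
  let ?F = "rec6_cut k 7" and ?F' = "rec6_cut_deriv k 7"
  let ?\<psi> = "\<lambda>t. 49 / 51 * rec6_cut k 17 t" and ?\<psi>' = "\<lambda>t. 49 / 51 * rec6_cut_deriv k 17 t"
  let ?B = "(204 * rec6 k) ^ 40"
  have F: "cutoff ?F ?F'" using cutoff_rec6[of 7 1] by simp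
  have \<psi>: "cutoff ?\<psi> ?\<psi>'" by (rule cutoff_rec6) simp
  have iF: "integrable lborel (extend0 (\<lambda>x. (?F (u x))\<^sup>2 / (u x)\<^sup>2))"
    using u_pos
    by (intro integrable_extend0 continuous_intros cutoff_cont[OF F] continuous_u)
      (auto simp: cutoff_0[OF F] less_imp_neq[symmetric])
  have i\<psi>: "integrable lborel (extend0 (\<lambda>x. ?\<psi> (u x) / u x))"
    using u_pos
    by (intro integrable_extend0 continuous_intros cutoff_cont[OF \<psi>] continuous_u)
      (auto simp: cutoff_0[OF \<psi>, simplified] less_imp_neq[symmetric])
  have "(LINT x|lborel. extend0 (\<lambda>x. (?F (u x))\<^sup>2 / (u x)\<^sup>2) x)
      \<le> (LINT x:\<Omega>|lborel. (norm (grad (\<lambda>x. ?F (u x)) x))\<^sup>2)"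
    using assms test_function_cutoff[OF F]
    by (auto simp: stable_def set_lebesgue_integral_extend0[symmetric])
  also have "\<dots> = (LINT x|lborel. extend0 (\<lambda>x. (?F' (u x))\<^sup>2 * (norm (grad u x))\<^sup>2) x)"
    unfolding set_lebesgue_integral_extend0
    by (intro Bochner_Integration.integral_cong)
      (auto simp: extend0_def GDERIV_imp_grad(1)[OF GDERIV_cutoff[OF F]] power_mult_distrib)
  also have "\<dots> \<le> (LINT x|lborel. extend0 (\<lambda>x. - ?\<psi>' (u x) * (norm (grad u x))\<^sup>2) x)"
  proof (rule integral_mono)
    show "integrable lborel (extend0 (\<lambda>x. (?F' (u x))\<^sup>2 * (norm (grad u x))\<^sup>2))"
      by (intro integrable_extend0 continuous_intros cutoff_cont'[OF F] continuous_grad)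
        (auto simp: cutoff_0[OF F])
    show "integrable lborel (extend0 (\<lambda>x. - ?\<psi>' (u x) * (norm (grad u x))\<^sup>2))"
      by (intro integrable_extend0 continuous_intros cutoff_cont'[OF \<psi>] continuous_grad)
        (auto simp: cutoff_0[OF \<psi>, simplified])
    fix x
    show "extend0 (\<lambda>x. (?F' (u x))\<^sup>2 * (norm (grad u x))\<^sup>2) x
        \<le> extend0 (\<lambda>x. - ?\<psi>' (u x) * (norm (grad u x))\<^sup>2) x"
      using mult_right_mono[OF rec6_cut_deriv_square_le[OF u_pos], of x "(norm (grad u x))\<^sup>2"]
      by (simp add: extend0_def)
  qed
  also have "\<dots> = (LINT x|lborel. extend0 (\<lambda>x. ?\<psi> (u x) / u x) x)"
    using energy_identity[OF \<psi>] unfolding set_lebesgue_integral_extend0 .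
  finally have "(LINT x|lborel. extend0 (\<lambda>x. (?F (u x))\<^sup>2 / (u x)\<^sup>2) x
      - extend0 (\<lambda>x. ?\<psi> (u x) / u x) x) \<le> 0"
    using Bochner_Integration.integral_diff[OF iF i\<psi>] by simp
  moreover have "rec_moment / 51 - ?B * measure lborel \<Omega>
      \<le> (LINT x|lborel. extend0 (\<lambda>x. (?F (u x))\<^sup>2 / (u x)\<^sup>2) x - extend0 (\<lambda>x. ?\<psi> (u x) / u x) x)"
  proof -
    have i\<Omega>: "integrable lborel (indicator \<Omega> :: _ \<Rightarrow> real)"
      using open_\<Omega> emeasure_bounded_finite[OF bounded_\<Omega>] by (intro integrable_real_indicator) auto
    have "rec_moment / 51 - ?B * measure lborel \<Omega>
        = (LINT x|lborel. indicator K x * rec6 (u x) ^ 40 / 51 - ?B * indicator \<Omega> x)"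
      using i\<Omega> integrable_rec6 open_\<Omega> unfolding rec_moment_def
      by (subst Bochner_Integration.integral_diff) auto
    also have "\<dots> \<le> (LINT x|lborel. extend0 (\<lambda>x. (?F (u x))\<^sup>2 / (u x)\<^sup>2) x
        - extend0 (\<lambda>x. ?\<psi> (u x) / u x) x)"
    proof (rule integral_mono)
      show "integrable lborel (\<lambda>x. indicator K x * rec6 (u x) ^ 40 / 51 - ?B * indicator \<Omega> x)"
        using i\<Omega> integrable_rec6 by (intro Bochner_Integration.integrable_diff) auto
      show "integrable lborel (\<lambda>x. extend0 (\<lambda>x. (?F (u x))\<^sup>2 / (u x)\<^sup>2) x
          - extend0 (\<lambda>x. ?\<psi> (u x) / u x) x)"
        by (rule Bochner_Integration.integrable_diff[OF iF i\<psi>])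
      fix x
      consider "x \<in> K" | "x \<in> \<Omega> - K" | "x \<notin> \<Omega>" by blast
      then show "indicator K x * rec6 (u x) ^ 40 / 51 - ?B * indicator \<Omega> x
          \<le> extend0 (\<lambda>x. (?F (u x))\<^sup>2 / (u x)\<^sup>2) x - extend0 (\<lambda>x. ?\<psi> (u x) / u x) x"
      proof cases
        case 1
        then have "x \<in> \<Omega>" "u x \<le> k" by (auto simp: K_def)
        with rec6_cut_gap[OF u_pos this(2)] 1 show ?thesis by (simp add: extend0_def)
      next
        case 2
        then show ?thesis
          using cutoff_0[OF F 2] cutoff_0[OF \<psi> 2] rec6_pos[OF k_pos] by (simp add: extend0_def)
      next
        case 3
        then show ?thesis using K_subset by (auto simp: extend0_def indicator_def)
      qed
    qed
    finally show ?thesis .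
  qed
  ultimately show ?thesis by simp
qed

end

section \<open>The lower bound\<close>

context dirichlet_solution
begin

text \<open>A concave increasing function with a continuous second derivative that is constant above
  level \<open>k\<close> and comparable with positive \<open>t\<close> below it. Concavity makes the term with the squared gradient in
  the Laplacian of \<open>cap (u x)\<close> nonpositive, so truncation preserves the upper bound for the
  Laplacian, and the truncated solution extends to the whole space.\<close>

definition cap where "cap t = k / 3 * (1 - (max 0 (1 - t / k)) ^ 3)"

definition cap_deriv where "cap_deriv t = (max 0 (1 - t / k))\<^sup>2"

definition cap_deriv2 where "cap_deriv2 t = - (2 / k) * max 0 (1 - t / k)"

lemma DERIV_cap: "(cap has_field_derivative cap_deriv t) (at t)"
  and DERIV_cap_deriv: "(cap_deriv has_field_derivative cap_deriv2 t) (at t)"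
proof -
  have 1: "((\<lambda>t. 1 - t / k) has_field_derivative - (1 / k)) (at t)"
    using k_pos by (auto intro!: derivative_eq_intros)
  have "((\<lambda>t. k / 3 * (1 - max 0 (1 - t / k) ^ 3)) has_field_derivative
      k / 3 * (0 - (3 * (max 0 (1 - t / k))\<^sup>2) * - (1 / k))) (at t)"
  proof (rule DERIV_cmult[OF DERIV_diff[OF DERIV_const]])
    show "((\<lambda>t. max 0 (1 - t / k) ^ 3) has_field_derivative
        3 * (max 0 (1 - t / k))\<^sup>2 * - (1 / k)) (at t)"
      using DERIV_chain2[OF DERIV_max_0_power[of 1] 1] by (simp add: numeral_2_eq_2 numeral_3_eq_3)
  qed
  moreover have "k / 3 * (0 - (3 * (max 0 (1 - t / k))\<^sup>2) * - (1 / k)) = cap_deriv t"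
    using k_pos by (simp add: cap_deriv_def)
  ultimately show "(cap has_field_derivative cap_deriv t) (at t)"
    unfolding cap_def[abs_def] by simp
  have "((\<lambda>t. (max 0 (1 - t / k))\<^sup>2) has_field_derivative
      (2 * max 0 (1 - t / k)) * - (1 / k)) (at t)"
    using DERIV_chain2[OF DERIV_max_0_power[of 0] 1] by (simp add: numeral_2_eq_2)
  then show "(cap_deriv has_field_derivative cap_deriv2 t) (at t)"
    unfolding cap_deriv_def[abs_def] cap_deriv2_def by (simp add: mult_ac)
qed

lemma cutoff_cap_deriv: "cutoff cap_deriv cap_deriv2"
  unfolding cutoff_def
proof (intro conjI allI impI DERIV_cap_deriv)
  show "continuous_on {0<..} cap_deriv2" unfolding cap_deriv2_def by (intro continuous_intros) (use k_pos in auto)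
  show "cap_deriv t = 0" "cap_deriv2 t = 0" if "k < t" for t
    using that k_pos by (auto simp: cap_deriv_def cap_deriv2_def)
qed

lemma cap_beyond: "k \<le> t \<Longrightarrow> cap t = k / 3"
  using k_pos by (simp add: cap_def)

lemma cap_bounds:
  assumes "0 < t" "t \<le> k"
  shows "t / 3 \<le> cap t" "cap t \<le> t"
proof -
  define x where "x = t / k"
  have x: "0 < x" "x \<le> 1" "t = k * x" using assms k_pos by (auto simp: x_def)
  have c: "cap t = k / 3 * (1 - (1 - x) ^ 3)" using x(2) by (simp add: cap_def flip: x_def)
  have "(1 - x) ^ 3 \<le> (1 - x) ^ 1" using x by (intro power_decreasing) auto
  then have "x \<le> 1 - (1 - x) ^ 3" by simp
  from mult_left_mono[OF this, of "k / 3"] show "t / 3 \<le> cap t" using k_pos c x(3) by simp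
  have "1 + real 3 * (- x) \<le> (1 + (- x)) ^ 3"
    using x by (intro Bernoulli_inequality) auto
  then have "1 - (1 - x) ^ 3 \<le> 3 * x" by simp
  then have "cap t \<le> k / 3 * (3 * x)" unfolding c using k_pos by (intro mult_left_mono) auto
  then show "cap t \<le> t" using x(3) by simp
qed

lemma cap_pos: "0 < t \<Longrightarrow> 0 < cap t"
  using cap_bounds(1)[of t] cap_beyond[of t] k_pos by (cases "t \<le> k") auto

lemma cap_le: "0 < t \<Longrightarrow> cap t \<le> t"
  using cap_bounds(2)[of t] cap_beyond[of t] k_pos by (cases "t \<le> k") auto

definition u_cap where "u_cap x = (if x \<in> \<Omega> then cap (u x) else k / 3)"

lemma u_cap_pos: "0 < u_cap x"
  using k_pos cap_pos u_pos by (simp add: u_cap_def)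

lemma GDERIV_u_cap: "GDERIV u_cap x :> flux cap_deriv x"
proof -
  have "GDERIV (\<lambda>x. cap (u x)) x :> cap_deriv (u x) *\<^sub>R grad u x" if "x \<in> \<Omega>" for x
    using that by (intro GDERIV_DERIV_compose GDERIV_u DERIV_cap)
  then show ?thesis
    unfolding u_cap_def[abs_def] flux_def extend0_def
    by (rule GDERIV_extend_const[OF open_\<Omega> closed_K K_subset])
      (use off_K cap_beyond in \<open>auto simp: less_imp_le\<close>)
qed

lemma laplacian_u_cap_le: "(\<Sum>i\<in>UNIV. flux_grad cap_deriv cap_deriv2 i x $ i) \<le> 1 / u_cap x"
proof (cases "x \<in> \<Omega>")
  case True
  have "cap_deriv2 (u x) * (norm (grad u x))\<^sup>2 \<le> 0"
    using k_pos by (intro mult_nonpos_nonneg) (auto simp: cap_deriv2_def)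
  moreover have "cap_deriv (u x) \<le> 1"
    using u_pos[OF True] k_pos unfolding cap_deriv_def by (intro power_le_one) auto
  then have "cap_deriv (u x) / u x \<le> 1 / u x" using u_pos[OF True] by (intro divide_right_mono) auto
  moreover have "1 / u x \<le> 1 / u_cap x"
    using True u_pos[OF True] cap_le cap_pos by (intro divide_left_mono) (auto simp: u_cap_def)
  ultimately show ?thesis
    using True unfolding flux_div[OF cutoff_cap_deriv] flux_div_def extend0_def by simp
next
  case False
  then show ?thesis
    using u_cap_pos[of x] unfolding flux_div[OF cutoff_cap_deriv] flux_div_def extend0_def
    by (simp add: less_imp_le)
qed

text \<open>The parameter \<open>\<rho>\<close> trades the first power of \<open>1 / u\<close>, on which the mean value argument depends,
  for the power \<open>20 / 3\<close> that stability controls: with \<open>s\<close> the sixth root of \<open>1 / u\<close>, either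
  \<open>s ^ 6 \<le> \<rho> powr - 9\<close>, or \<open>s\<^sup>2 * \<rho> ^ 3 \<ge> 1\<close> and multiplying by the seventeenth power of the
  latter costs nothing.\<close>

lemma reciprocal_u_cap_le:
  assumes "0 < \<rho>" "\<rho> \<le> 1"
  shows "1 / u_cap x \<le> 3 / k + 3 / \<rho> ^ 9 + 3 * \<rho> ^ 51 * (indicator K x * rec6 (u x) ^ 40)"
proof (cases "x \<in> K")
  case True
  then have x: "x \<in> \<Omega>" "u x \<le> k" by (auto simp: K_def)
  define s where "s = rec6 (u x)"
  have s: "0 < s" "s ^ 6 = 1 / u x"
    using u_pos[OF x(1)] by (auto simp: s_def rec6_pos rec6_power6)
  have "1 / u_cap x \<le> 1 / (u x / 3)"
    using cap_bounds(1)[OF u_pos[OF x(1)] x(2)] x(1) u_pos[OF x(1)] cap_pos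
    by (intro divide_left_mono) (auto simp: u_cap_def)
  then have le: "1 / u_cap x \<le> 3 * s ^ 6" using s by simp
  have "s ^ 6 \<le> 1 / \<rho> ^ 9 + \<rho> ^ 51 * s ^ 40"
  proof (cases "s ^ 2 * \<rho> ^ 3 \<le> 1")
    case True
    have "(s ^ 2 * \<rho> ^ 3) ^ 3 \<le> 1" using True s assms by (intro power_le_one) auto
    then have "s ^ 6 * \<rho> ^ 9 \<le> 1" by (simp add: power_mult_distrib flip: power_mult)
    then have "s ^ 6 \<le> 1 / \<rho> ^ 9" using assms by (simp add: field_simps)
    moreover have "0 \<le> \<rho> ^ 51 * s ^ 40" using assms s by simp
    ultimately show ?thesis by linarith
  next
    case False
    then have "1 \<le> (s ^ 2 * \<rho> ^ 3) ^ 17" by (intro one_le_power) simp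
    from mult_left_mono[OF this, of "s ^ 6"]
    have "s ^ 6 \<le> s ^ 6 * (s ^ 2 * \<rho> ^ 3) ^ 17" using s(1) by simp
    also have "\<dots> = \<rho> ^ 51 * s ^ 40"
      by (simp add: power_mult_distrib mult_ac flip: power_mult power_add)
    finally show ?thesis using assms by (simp add: add_increasing)
  qed
  moreover have "0 < 3 / k" using k_pos by simp
  ultimately have "1 / u_cap x \<le> 3 / k + 3 / \<rho> ^ 9 + 3 * \<rho> ^ 51 * s ^ 40" using le by linarith
  then show ?thesis using True by (simp add: s_def)
next
  case False
  have "u_cap x = k / 3" using False cap_beyond[of "u x"] by (auto simp: u_cap_def K_def)
  then have "1 / u_cap x = 1 / (k / 3)" by (simp only:)
  moreover have "0 \<le> 3 / \<rho> ^ 9" using assms by simp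
  ultimately show ?thesis using False by simp
qed

text \<open>Undoing a dilation by \<open>\<rho> ^ 10\<close> in dimension at most six costs at most \<open>\<rho> powr - 60\<close>, which turns
  the factor \<open>\<rho> ^ 51\<close> of the controlled power into \<open>\<rho> powr - 9\<close>. This is where the dimension has to
  be smaller than the exponent \<open>20 / 3\<close>.\<close>

lemma dilated_reciprocal_bound:
  assumes "CARD('n) \<le> 6" and \<rho>: "0 < \<rho>" "\<rho> \<le> 1"
  defines "Z \<equiv> LINT y|lborel. bump (y :: real^'n)"
  shows "(LINT y|lborel. 1 / u_cap (x0 + \<rho> ^ 10 *\<^sub>R y) * bump y) \<le> (3 * Z / k + 3 * Z + 3 * rec_moment) / \<rho> ^ 9"
proof -
  let ?g = "\<lambda>x. indicator K x * rec6 (u x) ^ 40 :: real"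
  have r: "0 < \<rho> ^ 10" using \<rho> by simp
  note g = integral_lborel_scale[OF integrable_rec6 r, of x0]
  have Z: "0 < Z" unfolding Z_def by (rule integral_bump_pos)
  have rec_moment: "0 \<le> rec_moment" unfolding rec_moment_def
    using u_pos rec6_pos K_subset
    by (intro Bochner_Integration.integral_nonneg) (auto simp: indicator_def intro!: less_imp_le)
  have g_nonneg: "0 \<le> ?g x" for x
    using u_pos rec6_pos K_subset by (auto simp: indicator_def intro!: less_imp_le)
  have cv: "continuous_on UNIV u_cap" using GDERIV_u_cap by (rule GDERIV_imp_continuous)
  have "(LINT y|lborel. 1 / u_cap (x0 + \<rho> ^ 10 *\<^sub>R y) * bump y)
      \<le> (LINT y|lborel. (3 / k + 3 / \<rho> ^ 9) * bump y + 3 * \<rho> ^ 51 * ?g (x0 + \<rho> ^ 10 *\<^sub>R y))"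
  proof (rule integral_mono)
    show "integrable lborel (\<lambda>y. 1 / u_cap (x0 + \<rho> ^ 10 *\<^sub>R y) * bump y)"
      by (intro integrable_continuous_bump continuous_intros continuous_on_compose2[OF cv])
        (use u_cap_pos in \<open>auto simp: less_imp_neq[symmetric]\<close>)
    show "integrable lborel (\<lambda>y. (3 / k + 3 / \<rho> ^ 9) * bump y + 3 * \<rho> ^ 51 * ?g (x0 + \<rho> ^ 10 *\<^sub>R y))"
      by (intro Bochner_Integration.integrable_add integrable_mult_right integrable_bump g(1))
    fix y :: "real^'n"
    let ?x = "x0 + \<rho> ^ 10 *\<^sub>R y"
    have "1 / u_cap ?x * bump y \<le> (3 / k + 3 / \<rho> ^ 9 + 3 * \<rho> ^ 51 * ?g ?x) * bump y"
      by (intro mult_right_mono reciprocal_u_cap_le \<rho> bump_nonneg)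
    also have "\<dots> = (3 / k + 3 / \<rho> ^ 9) * bump y + (3 * \<rho> ^ 51 * ?g ?x) * bump y"
      by (rule distrib_right)
    also have "(3 * \<rho> ^ 51 * ?g ?x) * bump y \<le> 3 * \<rho> ^ 51 * ?g ?x"
      using \<rho> g_nonneg[of ?x] bump_le_1[of y] by (intro mult_left_le) auto
    finally show "1 / u_cap ?x * bump y \<le> (3 / k + 3 / \<rho> ^ 9) * bump y + 3 * \<rho> ^ 51 * ?g ?x" by simp
  qed
  also have "\<dots> = (3 / k + 3 / \<rho> ^ 9) * Z + 3 * \<rho> ^ 51 * (rec_moment / (\<rho> ^ 10) ^ CARD('n))"
    unfolding Z_def rec_moment_def g(2)[symmetric]
    by (subst Bochner_Integration.integral_add)
      (rule integrable_mult_right integrable_bump g(1) | simp)+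
  also have "\<dots> \<le> (3 / (k * \<rho> ^ 9) + 3 / \<rho> ^ 9) * Z + 3 * (rec_moment / \<rho> ^ 9)"
  proof (intro add_mono mult_right_mono)
    show "3 / k \<le> 3 / (k * \<rho> ^ 9)"
      using \<rho> k_pos by (intro divide_left_mono) (auto simp: mult_le_cancel_left1 power_le_one)
    have "\<rho> ^ 60 \<le> \<rho> ^ (10 * CARD('n))" using \<rho> assms(1) by (intro power_decreasing) auto
    then have "rec_moment / \<rho> ^ (10 * CARD('n)) \<le> rec_moment / \<rho> ^ 60"
      using \<rho> rec_moment by (intro divide_left_mono) auto
    then have "\<rho> ^ 51 * (rec_moment / (\<rho> ^ 10) ^ CARD('n)) \<le> \<rho> ^ 51 * (rec_moment / \<rho> ^ 60)"
      using \<rho> by (intro mult_left_mono) (auto simp: power_mult)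
    also have "\<dots> = rec_moment / \<rho> ^ 9"
    proof -
      have *: "\<rho> ^ 60 = \<rho> ^ 51 * \<rho> ^ 9" by (simp flip: power_add)
      show ?thesis
        unfolding * times_divide_eq_right
        by (rule mult_divide_mult_cancel_left) (use \<rho> in simp)
    qed
    finally show "3 * \<rho> ^ 51 * (rec_moment / (\<rho> ^ 10) ^ CARD('n)) \<le> 3 * (rec_moment / \<rho> ^ 9)" by simp
  qed (use Z in auto)
  also have "\<dots> = (3 * Z / k + 3 * Z + 3 * rec_moment) / \<rho> ^ 9"
    using \<rho> k_pos by (simp add: field_simps)
  finally show ?thesis .
qed

lemma solution_lower_bound:
  assumes "CARD('n) \<le> 6" "stable \<Omega> u" "x0 \<in> \<Omega>"
  defines "Z \<equiv> LINT y|lborel. bump (y :: real^'n)"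
  defines "C \<equiv> 3 * Z / k + 3 * Z + 3 * (51 * (204 * rec6 k) ^ 40 * measure lborel \<Omega>)"
  shows "3 / 4 * (Z / C) * min 1 (Z / C) ^ 9 \<le> u x0"
proof -
  have Z: "0 < Z" unfolding Z_def by (rule integral_bump_pos)
  have "0 < C" unfolding C_def
    using Z k_pos rec6_pos[OF k_pos] by (intro add_pos_nonneg) auto
  have "3 / 4 * (Z / C) * min 1 (Z / C) ^ 9 \<le> u_cap x0"
    unfolding Z_def
  proof (rule mean_value_reciprocal_lower_bound[OF u_cap_pos GDERIV_u_cap GDERIV_flux[OF cutoff_cap_deriv]
        continuous_flux_grad[OF cutoff_cap_deriv] laplacian_u_cap_le \<open>0 < C\<close>])
    fix \<rho> :: real assume \<rho>: "0 < \<rho>" "\<rho> \<le> 1"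
    have "(LINT y|lborel. 1 / u_cap (x0 + \<rho> ^ 10 *\<^sub>R y) * bump y) \<le> (3 * Z / k + 3 * Z + 3 * rec_moment) / \<rho> ^ 9"
      unfolding Z_def by (rule dilated_reciprocal_bound[OF assms(1) \<rho>])
    also have "\<dots> \<le> C / \<rho> ^ 9"
      unfolding C_def using reciprocal_power_bound[OF assms(2)] \<rho>
      by (intro divide_right_mono add_left_mono mult_left_mono) auto
    finally show "(LINT y|lborel. 1 / u_cap (x0 + \<rho> ^ 10 *\<^sub>R y) * bump y) \<le> C / \<rho> ^ 9" .
  qed
  also have "u_cap x0 \<le> u x0" using assms(3) cap_le[OF u_pos] by (simp add: u_cap_def)
  finally show ?thesis .
qed

end

theorem theorem3:
  fixes \<Omega> :: "(real^'n) set" and M \<epsilon> :: real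
  assumes "2 \<le> CARD('n)" and "CARD('n) \<le> 6"
    and "bounded_C11_domain \<Omega>"
    and "M > 0" and "\<epsilon> > 0"
  shows "\<exists>\<delta>>0. \<forall>\<alpha> \<phi> u.
           0 < \<alpha> \<and> \<alpha> < 1 \<and>
           C2_holder_on \<alpha> \<Omega> \<phi> \<and> continuous_on (closure \<Omega>) \<phi> \<and>
           holder_norm2 \<alpha> \<Omega> \<phi> \<le> ennreal M \<and> (\<forall>x\<in>\<Omega>. \<phi> x \<ge> \<epsilon>) \<and>
           positive_stable_solution \<Omega> \<phi> u
           \<longrightarrow> (\<forall>x\<in>\<Omega>. u x \<ge> \<delta>)"
proof -
  define k where "k = \<epsilon> / 2"
  define Z where "Z = (LINT y|lborel. bump (y :: real^'n))"
  define C where "C = 3 * Z / k + 3 * Z + 3 * (51 * (204 * rec6 k) ^ 40 * measure lborel \<Omega>)"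
  define \<delta> where "\<delta> = 3 / 4 * (Z / C) * min 1 (Z / C) ^ 9"
  have k: "0 < k" "k < \<epsilon>" using \<open>\<epsilon> > 0\<close> by (auto simp: k_def)
  have Z: "0 < Z" unfolding Z_def by (rule integral_bump_pos)
  have "0 < C" unfolding C_def
    using Z k rec6_pos[OF k(1)] by (intro add_pos_nonneg) auto
  then have "0 < \<delta>" using Z by (simp add: \<delta>_def)
  moreover have "\<delta> \<le> u x"
    if \<phi>: "continuous_on (closure \<Omega>) \<phi>" "\<forall>x\<in>\<Omega>. \<phi> x \<ge> \<epsilon>"
      and u: "positive_stable_solution \<Omega> \<phi> u" and x: "x \<in> \<Omega>" for \<phi> u x
  proof -
    interpret dirichlet_solution \<Omega> u k
    proof
      show "k < u y" if "y \<in> frontier \<Omega>" for y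
      proof -
        have "y \<in> closure \<Omega>" using that by (simp add: frontier_def)
        then have "\<epsilon> \<le> \<phi> y" using continuous_ge_on_closure[OF \<phi>(1)] \<phi>(2) by blast
        then show ?thesis using u that k by (simp add: positive_stable_solution_def)
      qed
    qed (use u k \<open>bounded_C11_domain \<Omega>\<close> in
        \<open>auto simp: positive_stable_solution_def bounded_C11_domain_def smooth_on_def\<close>)
    have "stable \<Omega> u" using u by (simp add: positive_stable_solution_def)
    from solution_lower_bound[OF assms(2) this x]
    show ?thesis unfolding \<delta>_def C_def Z_def .
  qed
  ultimately show ?thesis by blast
qed

end
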